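(* Let $n=4$, let $(M,g,\phi)$ be the four-dimensional Horowitz-Myers geon with parameters $0<a_3\le a_4$ and mass $m=-\pi a_3a_4$, and let $\Sigma\subset M$ be a graph over $T^3$. Assume $\Sigma$ is symmetric along the $\xi$ direction. Suppose that the second fundamental form $\bar h_{ab}$ of $\Sigma$ with respect to the conformal metric $\bar g=\left(\phi\frac{d\phi}{ds}\right)^2g$ is non-negative definite and that $$\min_\Sigma\phi^4\ge 1+\frac{2}{\sqrt3}.$$ Then $$Q(\Sigma)\le 2m,$$ where $Q(\Sigma)=12\int_\Omega \phi\,d\mathrm{vol}_g-\int_\Sigma \phi H\,d\mathrm{vol}_\gamma$. Moreover, equality holds if and only if $\Sigma$ is a coordinate torus $\{s\equiv\text{constant}\}$.
   Context: Four-dimensional Horowitz-Myers geon: fix $0<a_3\le a_4$ and let $\phi(s)=\cosh^{1/2}(2s)$, which satisfies $\frac{d\phi}{ds}=\phi(1-\phi^{-4})^{1/2}$. $M$ has coordinates $s\in[0,\infty)$, $\xi\in\mathbb{R}/\pi\mathbb{Z}$, $\theta^i\in\mathbb{R}/a_i\mathbb{Z}$ ($i=3,4$) and metric $$g=ds^2+\Big(\frac{d\phi}{ds}\Big)^2d\xi^2+\phi^2\big((d\theta^3)^2+(d\theta^4)^2\big).$$ The $\xi$-circle collapses at $s=0$, and the period of $\xi$ is such that $g$ is smooth there, so $M$ is diffeomorphic to $\mathbb{R}^2\times T^2$. $\phi$ and $\frac{d\phi}{ds}$ are regarded as functions on $M$ through $s$. A graph over $T^3=\mathbb{R}/\pi\mathbb{Z}\times\mathbb{R}/a_3\mathbb{Z}\times\mathbb{R}/a_4\mathbb{Z}$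 is a hypersurface $\Sigma=\{s=v(\xi,\theta^3,\theta^4)\}$ with $v$ a smooth function on $T^3$; it is symmetric along the $\xi$ direction if $v$ does not depend on $\xi$. $\Omega$ is the bounded region enclosed by $\Sigma$, i.e. $\{s<v\}$. $\gamma$ is the metric induced on $\Sigma$ by $g$, and $H$ is the mean curvature (trace of the second fundamental form) of $\Sigma$ in $(M,g)$ with respect to the outward unit normal $\nu$. The sign convention for the second fundamental form in any metric is $h(X,Y)=\langle\nabla_X\nu,Y\rangle$ with $\nu$ the outward unit normal of that metric; $\bar h_{ab}$ is this form computed for $\bar g$ (a Riemannian metric on $\{s>0\}$). *)

theory Defs
  imports "HOL-Analysis.Analysis"
begin

section \<open>Riemannian geometry of parametrised hypersurfaces in a chart\<close>

text \<open>A metric on a coordinate chart is a matrix-valued function \<open>G\<close>, where \<open>G x $ i $ j\<close> is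
  the component \<open>g\<^sub>i\<^sub>j\<close> at \<open>x\<close>. A hypersurface is given by a parametrisation \<open>f\<close>, and a vector
  field along it is a function of the parameter \<open>p\<close> with values in the tangent space of the
  chart at \<open>f p\<close>.\<close>

definition partial_deriv ::
    "'n \<Rightarrow> (real^'n \<Rightarrow> 'b::real_normed_vector) \<Rightarrow> real^'n \<Rightarrow> 'b" where
  "partial_deriv i f x = frechet_derivative f (at x) (axis i 1)"

text \<open>Differentiability of every iterated partial derivative entails continuity of all of them.\<close>

definition smooth_map :: "(real^'n \<Rightarrow> 'b::real_normed_vector) \<Rightarrow> bool" where
  "smooth_map f \<longleftrightarrow> (\<forall>is x. foldr partial_deriv is f differentiable (at x))"

definition metric_inner :: "(real^'n \<Rightarrow> real^'n^'n) \<Rightarrow> real^'n \<Rightarrow> real^'n \<Rightarrow> real^'n \<Rightarrow> real" where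
  "metric_inner G x X Y = X \<bullet> (G x *v Y)"

text \<open>\<open>christoffel G x k i j\<close> is the Christoffel symbol with upper index \<open>k\<close> and lower indices
  \<open>i\<close>, \<open>j\<close> of the Levi-Civita connection.\<close>

definition christoffel :: "(real^'n \<Rightarrow> real^'n^'n) \<Rightarrow> real^'n \<Rightarrow> 'n \<Rightarrow> 'n \<Rightarrow> 'n \<Rightarrow> real" where
  "christoffel G x k i j = (1/2) * (\<Sum>l\<in>UNIV. matrix_inv (G x) $ k $ l *
     (partial_deriv i (\<lambda>y. G y $ j $ l) x + partial_deriv j (\<lambda>y. G y $ i $ l) x
      - partial_deriv l (\<lambda>y. G y $ i $ j) x))"

text \<open>Levi-Civita derivative, in the direction of the \<open>a\<close>-th coordinate tangent vector of \<open>f\<close>,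
  of a vector field \<open>V\<close> along \<open>f\<close>.\<close>

definition covariant_deriv ::
    "(real^'n \<Rightarrow> real^'n^'n) \<Rightarrow> (real^'m \<Rightarrow> real^'n) \<Rightarrow> (real^'m \<Rightarrow> real^'n) \<Rightarrow> 'm \<Rightarrow> real^'m \<Rightarrow> real^'n"
  where
  "covariant_deriv G f V a p = (\<chi> k. partial_deriv a V p $ k
     + (\<Sum>i\<in>UNIV. \<Sum>j\<in>UNIV. christoffel G (f p) k i j * partial_deriv a f p $ i * V p $ j))"

definition induced_metric ::
    "(real^'n \<Rightarrow> real^'n^'n) \<Rightarrow> (real^'m \<Rightarrow> real^'n) \<Rightarrow> real^'m \<Rightarrow> real^'m^'m" where
  "induced_metric G f p =
     (\<chi> a b. metric_inner G (f p) (partial_deriv a f p) (partial_deriv b f p))"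

text \<open>The unit normal along \<open>f\<close> pointing out of the region \<open>{F < 0}\<close>, for a defining function
  \<open>F\<close> of the hypersurface.\<close>

definition outward_unit_normal ::
    "(real^'n \<Rightarrow> real^'n^'n) \<Rightarrow> (real^'m \<Rightarrow> real^'n) \<Rightarrow> (real^'n \<Rightarrow> real) \<Rightarrow> real^'m \<Rightarrow> real^'n" where
  "outward_unit_normal G f F p = (THE N.
     metric_inner G (f p) N N = 1 \<and>
     (\<forall>a. metric_inner G (f p) N (partial_deriv a f p) = 0) \<and>
     frechet_derivative F (at (f p)) N > 0)"

definition second_fundamental_form ::
    "(real^'n \<Rightarrow> real^'n^'n) \<Rightarrow> (real^'m \<Rightarrow> real^'n) \<Rightarrow> (real^'n \<Rightarrow> real) \<Rightarrow> real^'m \<Rightarrow> real^'m^'m" where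
  "second_fundamental_form G f F p = (\<chi> a b. metric_inner G (f p)
     (covariant_deriv G f (outward_unit_normal G f F) a p) (partial_deriv b f p))"

definition mean_curvature ::
    "(real^'n \<Rightarrow> real^'n^'n) \<Rightarrow> (real^'m \<Rightarrow> real^'n) \<Rightarrow> (real^'n \<Rightarrow> real) \<Rightarrow> real^'m \<Rightarrow> real" where
  "mean_curvature G f F p = (\<Sum>a\<in>UNIV. \<Sum>b\<in>UNIV.
     matrix_inv (induced_metric G f p) $ a $ b * second_fundamental_form G f F p $ a $ b)"

definition nonneg_definite :: "real^'n^'n \<Rightarrow> bool" where
  "nonneg_definite A \<longleftrightarrow> (\<forall>X. X \<bullet> (A *v X) \<ge> 0)"


section \<open>The four-dimensional Horowitz-Myers geon\<close>

text \<open>Ambient coordinates are \<open>x$1 = s\<close>, \<open>x$2 = \<xi>\<close>, \<open>x$3 = \<theta>\<^sup>3\<close>, \<open>x$4 = \<theta>\<^sup>4\<close>, and torus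
  coordinates are \<open>p$1 = \<xi>\<close>, \<open>p$2 = \<theta>\<^sup>3\<close>, \<open>p$3 = \<theta>\<^sup>4\<close>. The circle coordinates are lifted to the
  real line: functions on the torus are periodic functions, subsets of the geon are described by
  their lifts, and integrals are taken over one period cell. The chart covers \<open>s > 0\<close>; the locus
  \<open>s = 0\<close>, where the \<open>\<xi>\<close>-circle collapses, has measure zero.\<close>

definition geon_phi :: "real \<Rightarrow> real" where
  "geon_phi s = sqrt (cosh (2 * s))"

definition geon_metric :: "real^4 \<Rightarrow> real^4^4" where
  "geon_metric x = (\<chi> i j. if i \<noteq> j then 0
     else if i = 1 then 1
     else if i = 2 then (deriv geon_phi (x$1))\<^sup>2
     else (geon_phi (x$1))\<^sup>2)"

definition conformal_geon_metric :: "real^4 \<Rightarrow> real^4^4" where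
  "conformal_geon_metric x = (geon_phi (x$1) * deriv geon_phi (x$1))\<^sup>2 *\<^sub>R geon_metric x"

definition geon_mass :: "real \<Rightarrow> real \<Rightarrow> real" where
  "geon_mass a3 a4 = - pi * a3 * a4"

definition smooth_on_torus :: "real \<Rightarrow> real \<Rightarrow> (real^3 \<Rightarrow> real) \<Rightarrow> bool" where
  "smooth_on_torus a3 a4 v \<longleftrightarrow> smooth_map v \<and>
     (\<forall>p. v (p + axis 1 pi) = v p \<and> v (p + axis 2 a3) = v p \<and> v (p + axis 3 a4) = v p)"

definition torus_cell :: "real \<Rightarrow> real \<Rightarrow> (real^3) set" where
  "torus_cell a3 a4 = {p. p$1 \<in> {0..<pi} \<and> p$2 \<in> {0..<a3} \<and> p$3 \<in> {0..<a4}}"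

definition torus_part :: "real^4 \<Rightarrow> real^3" where
  "torus_part x = vector [x$2, x$3, x$4]"

definition graph_param :: "(real^3 \<Rightarrow> real) \<Rightarrow> real^3 \<Rightarrow> real^4" where
  "graph_param v p = vector [v p, p$1, p$2, p$3]"

definition graph_surface :: "(real^3 \<Rightarrow> real) \<Rightarrow> (real^4) set" where
  "graph_surface v = {x. x$1 = v (torus_part x)}"

definition graph_defining_fun :: "(real^3 \<Rightarrow> real) \<Rightarrow> real^4 \<Rightarrow> real" where
  "graph_defining_fun v x = x$1 - v (torus_part x)"

definition xi_symmetric :: "(real^3 \<Rightarrow> real) \<Rightarrow> bool" where
  "xi_symmetric v \<longleftrightarrow> (\<forall>p q. p$2 = q$2 \<and> p$3 = q$3 \<longrightarrow> v p = v q)"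

definition enclosed_region :: "real \<Rightarrow> real \<Rightarrow> (real^3 \<Rightarrow> real) \<Rightarrow> (real^4) set" where
  "enclosed_region a3 a4 v =
     {x. 0 \<le> x$1 \<and> x$1 < v (torus_part x) \<and> torus_part x \<in> torus_cell a3 a4}"

definition geon_Q :: "real \<Rightarrow> real \<Rightarrow> (real^3 \<Rightarrow> real) \<Rightarrow> real" where
  "geon_Q a3 a4 v =
     12 * (LINT x:enclosed_region a3 a4 v|lborel. geon_phi (x$1) * sqrt (det (geon_metric x)))
     - (LINT p:torus_cell a3 a4|lborel.
          geon_phi (v p)
          * mean_curvature geon_metric (graph_param v) (graph_defining_fun v) p
          * sqrt (det (induced_metric geon_metric (graph_param v) p)))"

end

theory Submission
  imports Defs
begin

text \<open>Write \<open>c = cosh (2 v)\<close>, \<open>u = sinh (2 v)\<close> and \<open>W\<^sup>2 = 1 + \<bar>Dv\<bar>\<^sup>2 / c\<close> for a graph \<open>s = v\<close> that does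
  not depend on \<open>\<xi>\<close>. Let \<open>S\<close> be the \<open>\<theta>\<close>-part of the conformal second fundamental form, normalised so
  that \<open>S = - D\<^sup>2v + \<dots>\<close>. Then
  \<open>\<phi> H dvol\<^sub>\<gamma> = (3 c\<^sup>2 - 1) + E - div (u Dv / W)\<close>, where
  \<open>E = u / (c W (W + 1)) (S(JDv, JDv) + S(Dv, Dv) / W\<^sup>2) + (3 c\<^sup>2 - 1) (W - 1)\<^sup>2 / W\<close> and \<open>J\<close> is the
  rotation by a right angle. The divergence integrates to zero over the torus and the volume term of
  \<open>Q\<close> is the integral of \<open>3 (c\<^sup>2 - 1)\<close>, so \<open>Q = 2 m - \<integral>E\<close>. Convexity gives
  \<open>E \<ge> (3 c\<^sup>2 - 1) (W - 1)\<^sup>2 / W \<ge> 0\<close>, and \<open>\<integral>E = 0\<close> forces \<open>W = 1\<close>, that is \<open>Dv = 0\<close>.\<close>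

section \<open>Partial derivatives and matrix inverses\<close>

lemma smooth_map_differentiable: "smooth_map f \<Longrightarrow> f differentiable (at x)"
  unfolding smooth_map_def by (metis foldr_Nil id_apply)

lemma smooth_map_partial_deriv:
  assumes "smooth_map f" shows "smooth_map (partial_deriv i f)"
  unfolding smooth_map_def
proof (intro allI)
  fix js x
  show "foldr partial_deriv js (partial_deriv i f) differentiable (at x)"
    using assms[unfolded smooth_map_def, rule_format, of "js @ [i]" x] by simp
qed

lemma smooth_map_continuous: "smooth_map f \<Longrightarrow> continuous_on S f"
  by (meson continuous_at_imp_continuous_on differentiable_imp_continuous_within smooth_map_differentiable)

lemma partial_deriv_eqI:
  "(f has_derivative f') (at x) \<Longrightarrow> partial_deriv i f x = f' (axis i 1)"
  unfolding partial_deriv_def by (metis frechet_derivative_at)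

lemma has_derivative_partial_derivs:
  fixes f :: "real^'n \<Rightarrow> 'b::real_normed_vector"
  assumes "f differentiable (at x)"
  shows "(f has_derivative (\<lambda>h. \<Sum>i\<in>UNIV. h $ i *\<^sub>R partial_deriv i f x)) (at x)"
proof -
  have d: "(f has_derivative frechet_derivative f (at x)) (at x)"
    using assms frechet_derivative_works by blast
  have l: "linear (frechet_derivative f (at x))"
    using d has_derivative_linear by blast
  have "frechet_derivative f (at x) h = (\<Sum>i\<in>UNIV. h $ i *\<^sub>R partial_deriv i f x)" for h
  proof -
    have "h = (\<Sum>i\<in>UNIV. h $ i *\<^sub>R axis i 1)"
      using basis_expansion[of h] by (simp add: scalar_mult_eq_scaleR)
    then have "frechet_derivative f (at x) h
        = frechet_derivative f (at x) (\<Sum>i\<in>UNIV. h $ i *\<^sub>R axis i 1)" by simp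
    also have "\<dots> = (\<Sum>i\<in>UNIV. h $ i *\<^sub>R partial_deriv i f x)"
      unfolding partial_deriv_def by (simp add: linear_sum[OF l] linear_scale[OF l])
    finally show ?thesis .
  qed
  then have "frechet_derivative f (at x) = (\<lambda>h. \<Sum>i\<in>UNIV. h $ i *\<^sub>R partial_deriv i f x)" ..
  with d show ?thesis by simp
qed

lemma partial_deriv_has_real_derivative:
  fixes f :: "real^'n \<Rightarrow> real"
  assumes "f differentiable (at (x + t *\<^sub>R axis i 1))"
  shows "((\<lambda>t. f (x + t *\<^sub>R axis i 1)) has_real_derivative partial_deriv i f (x + t *\<^sub>R axis i 1)) (at t)"
proof -
  have d: "(f has_derivative frechet_derivative f (at (x + t *\<^sub>R axis i 1))) (at (x + t *\<^sub>R axis i 1))"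
    using assms frechet_derivative_works by blast
  have "((\<lambda>t. f (x + t *\<^sub>R axis i 1)) has_derivative
      (\<lambda>h. frechet_derivative f (at (x + t *\<^sub>R axis i 1)) (h *\<^sub>R axis i 1))) (at t)"
    by (rule has_derivative_compose[where f = "\<lambda>t. x + t *\<^sub>R axis i 1", OF _ d])
      (auto intro!: derivative_eq_intros)
  moreover have "frechet_derivative f (at (x + t *\<^sub>R axis i 1)) (h *\<^sub>R axis i 1)
      = partial_deriv i f (x + t *\<^sub>R axis i 1) * h" for h
    by (simp add: partial_deriv_def linear_scale[OF has_derivative_linear[OF d]])
  ultimately show ?thesis
    by (simp add: has_field_derivative_def)
qed

lemma partial_deriv_periodic:
  assumes "\<And>x. f (x + w) = f x" and "f differentiable (at (x + w))"
  shows "partial_deriv i f (x + w) = partial_deriv i f x"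
proof -
  have "((\<lambda>x. x + w) has_derivative (\<lambda>h. h)) (at x)"
    by (auto intro!: derivative_eq_intros)
  moreover have "(f has_derivative frechet_derivative f (at (x + w))) (at (x + w))"
    using assms(2) frechet_derivative_works by blast
  ultimately have "((\<lambda>x. f (x + w)) has_derivative frechet_derivative f (at (x + w))) (at x)"
    by (rule has_derivative_compose)
  then show ?thesis
    unfolding assms(1) by (simp add: partial_deriv_eqI) (simp add: partial_deriv_def)
qed

lemma partial_deriv_vec_nth:
  assumes "f differentiable (at x)"
  shows "partial_deriv i f x $ k = partial_deriv i (\<lambda>y. f y $ k) x"
proof -
  have "((\<lambda>y. f y $ k) has_derivative (\<lambda>h. frechet_derivative f (at x) h $ k)) (at x)"
    using assms frechet_derivative_works
    by (intro bounded_linear.has_derivative[OF bounded_linear_vec_nth]) blast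
  then show ?thesis by (simp add: partial_deriv_eqI) (simp add: partial_deriv_def)
qed

text \<open>\<open>matrix_inv\<close> is a Hilbert choice among two-sided inverses. A right inverse
  of a square matrix is two-sided and unique, so one product identifies it.\<close>

lemma matrix_inv_eqI:
  fixes A B :: "real^'n^'n"
  assumes "A ** B = mat 1" shows "matrix_inv A = B"
proof -
  have 1: "A ** B = mat 1 \<and> B ** A = mat 1" using assms matrix_left_right_inverse by blast
  then have "A ** matrix_inv A = mat 1 \<and> matrix_inv A ** A = mat 1"
    unfolding matrix_inv_def by (rule someI)
  then show ?thesis using 1 by (metis matrix_mul_assoc matrix_mul_lid matrix_mul_rid)
qed

section \<open>Graphs in diagonal metrics\<close>

lemma vector_4 [simp]:
  "(vector [w,x,y,z] ::'a::zero^4)$1 = w"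
  "(vector [w,x,y,z] ::'a^4)$2 = x"
  "(vector [w,x,y,z] ::'a^4)$3 = y"
  "(vector [w,x,y,z] ::'a^4)$4 = z"
  unfolding vector_def by auto

text \<open>Places the torus coordinates after the height \<open>x$1\<close>, so that sums and
  quantifiers over the four chart indices split into a height term and a torus part.\<close>

definition torus_index :: "3 \<Rightarrow> 4" where
  "torus_index a = (if a = 1 then 2 else if a = 2 then 3 else 4)"

lemma torus_index_simps [simp]:
  "torus_index 1 = 2" "torus_index 2 = 3" "torus_index 3 = 4"
  by (auto simp: torus_index_def)

lemma torus_index_neq_1 [simp]: "torus_index a \<noteq> 1" "1 \<noteq> torus_index a"
  using exhaust_3[of a] by auto

lemma torus_index_inject [simp]: "torus_index a = torus_index b \<longleftrightarrow> a = b"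
  using exhaust_3[of a] exhaust_3[of b] by auto

lemma sum_torus_index:
  "(\<Sum>k\<in>(UNIV::4 set). F k) = F 1 + (\<Sum>a\<in>UNIV. F (torus_index a))"
  by (simp add: sum_4 sum_3 add.assoc)

lemma all_torus_index: "(\<forall>k::4. P k) \<longleftrightarrow> P 1 \<and> (\<forall>a. P (torus_index a))"
  by (simp add: forall_4 forall_3)

text \<open>Common shape of the geon metric and of its conformal rescaling: one computation of the
  second fundamental form serves both.\<close>

definition diag_metric :: "(4 \<Rightarrow> real \<Rightarrow> real) \<Rightarrow> real^4 \<Rightarrow> real^4^4" where
  "diag_metric g x = (\<chi> i j. if i = j then g i (x$1) else 0)"

section \<open>Inner product and Levi-Civita connection of a diagonal metric\<close>

lemma metric_inner_diag:
  "metric_inner (diag_metric g) x X Y = (\<Sum>k\<in>UNIV. g k (x$1) * X$k * Y$k)"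
proof -
  have "(diag_metric g x *v Y) $ k = g k (x$1) * Y $ k" for k
    by (simp add: diag_metric_def matrix_vector_mult_def mult_delta_left)
  then show ?thesis by (simp add: metric_inner_def inner_vec_def mult_ac)
qed

lemma matrix_inv_diag:
  assumes "\<And>k. g k (x$1) \<noteq> 0"
  shows "matrix_inv (diag_metric g x) = (\<chi> i j. if i = j then 1 / g i (x$1) else 0)"
  by (rule matrix_inv_eqI)
    (simp add: diag_metric_def matrix_matrix_mult_def mat_def vec_eq_iff mult_delta_left
      mult_delta_right assms)

lemma partial_deriv_diag_metric:
  assumes "\<And>k. (g k has_real_derivative g' k) (at (x$1))"
  shows "partial_deriv l (\<lambda>y. diag_metric g y $ i $ j) x = (if i = j \<and> l = 1 then g' i else 0)"
proof (cases "i = j")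
  case True
  have 1: "((\<lambda>y. y $ 1) has_derivative (\<lambda>h. h $ 1)) (at x)"
    by (rule bounded_linear_imp_has_derivative[OF bounded_linear_vec_nth])
  have "((\<lambda>y. g i (y$1)) has_derivative (\<lambda>h. g' i * h $ 1)) (at x)"
    using has_derivative_compose[OF 1 assms[of i, unfolded has_field_derivative_def]]
    by simp
  then have "((\<lambda>y. diag_metric g y $ i $ j) has_derivative (\<lambda>h. g' i * h $ 1)) (at x)"
    using True by (simp add: diag_metric_def)
  from partial_deriv_eqI[OF this] show ?thesis
    using True by (simp add: axis_def)
next
  case False
  then have "((\<lambda>y. diag_metric g y $ i $ j) has_derivative (\<lambda>h. 0)) (at x)"
    by (simp add: diag_metric_def)
  from partial_deriv_eqI[OF this] show ?thesis using False by simp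
qed

text \<open>Only diagonal entries and height derivatives survive, so a symbol can be nonzero only
  for the index patterns \<open>(k, 1, k)\<close>, \<open>(k, k, 1)\<close> and
  \<open>(1, i, i)\<close>. The contraction is the one that occurs in
  \<open>covariant_deriv\<close>.\<close>

lemma sum_christoffel_diag:
  assumes pos: "\<And>k. g k (x$1) \<noteq> 0"
    and g': "\<And>k. (g k has_real_derivative g' k) (at (x$1))"
  shows "(\<Sum>i\<in>UNIV. \<Sum>j\<in>UNIV. christoffel (diag_metric g) x k i j * A$i * B$j)
    = (g' k * (A$1 * B$k + A$k * B$1) - (if k = 1 then \<Sum>i\<in>UNIV. g' i * A$i * B$i else 0)) / (2 * g k (x$1))"
proof -
  have c: "christoffel (diag_metric g) x k i j =
     ((if i = 1 \<and> j = k then g' k else 0) + (if j = 1 \<and> i = k then g' k else 0)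
       - (if k = 1 \<and> i = j then g' i else 0)) / (2 * g k (x$1))" for i j
    unfolding christoffel_def matrix_inv_diag[of g x, OF pos]
      partial_deriv_diag_metric[of g g' x, OF g']
    by (simp add: mult_delta_left)
  \<comment> \<open>Nested conditionals instead of conjunctions let the delta rules collapse the
    double sum.\<close>
  have e: "christoffel (diag_metric g) x k i j * A$i * B$j =
     ((if i = 1 then if j = k then g' k * A$i*B$j else 0 else 0)
      + (if j = 1 then if i = k then g' k *A$i*B$j else 0 else 0)
       - (if i = j then if k = 1 then g' i *A$i*B$j else 0 else 0)) / (2 * g k (x$1))" for i j
    unfolding c by auto
  have out: "(\<Sum>j\<in>UNIV. if P then f j else 0) = (if P then \<Sum>j\<in>UNIV. f j else 0)"
    for P and f :: "4 \<Rightarrow> real" by simp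
  show ?thesis
    unfolding e sum_divide_distrib[symmetric] sum_subtractf sum.distrib
    by (simp add: out algebra_simps)
qed

section \<open>Tangent vectors and conormal of a graph\<close>

lemma graph_param_eq:
  "graph_param v p = v p *\<^sub>R axis 1 1 + (\<Sum>a\<in>UNIV. p $ a *\<^sub>R axis (torus_index a) 1)"
  unfolding vec_eq_iff forall_4 by (simp add: graph_param_def sum_3 axis_def)

lemma graph_param_nth [simp]:
  "graph_param v p $ 1 = v p" "graph_param v p $ torus_index a = p $ a"
  using exhaust_3[of a] by (auto simp: graph_param_def)

lemma torus_part_nth [simp]: "torus_part x $ a = x $ torus_index a"
  using exhaust_3[of a] by (auto simp: torus_part_def)

lemma torus_part_graph_param [simp]: "torus_part (graph_param v p) = p"
  by (simp add: vec_eq_iff)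

lemma partial_deriv_graph_param:
  assumes "v differentiable (at p)"
  shows "partial_deriv a (graph_param v) p = partial_deriv a v p *\<^sub>R axis 1 1 + axis (torus_index a) 1"
proof -
  have "(graph_param v has_derivative (\<lambda>h. (\<Sum>i\<in>UNIV. h $ i *\<^sub>R partial_deriv i v p) *\<^sub>R axis 1 1
       + (\<Sum>a\<in>UNIV. h $ a *\<^sub>R axis (torus_index a) 1))) (at p)"
    unfolding graph_param_eq[abs_def]
    by (rule has_derivative_partial_derivs[OF assms] derivative_intros
         bounded_linear.has_derivative[OF bounded_linear_scaleR_left]
         bounded_linear_imp_has_derivative[OF bounded_linear_vec_nth])+
  from partial_deriv_eqI[OF this] show ?thesis

    by (simp add: axis_def[of a] mult_delta_left if_distrib[of "\<lambda>r. r *\<^sub>R axis (torus_index _) 1"] cong: if_cong)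
qed

lemma bounded_linear_torus_part: "bounded_linear torus_part"
proof (rule linear_conv_bounded_linear[THEN iffD1], rule linearI)
qed (simp_all add: vec_eq_iff)

lemma graph_defining_fun_derivative:
  assumes "v differentiable (at p)"
  shows "frechet_derivative (graph_defining_fun v) (at (graph_param v p)) h
    = h $ 1 - (\<Sum>a\<in>UNIV. h $ torus_index a * partial_deriv a v p)"
proof -
  have "(v has_derivative (\<lambda>h. \<Sum>a\<in>UNIV. h $ a *\<^sub>R partial_deriv a v p)) (at (torus_part (graph_param v p)))"
    using has_derivative_partial_derivs[OF assms] by simp
  from has_derivative_compose[OF bounded_linear_imp_has_derivative[OF bounded_linear_torus_part] this]
  have "(graph_defining_fun v has_derivative
     (\<lambda>h. h $ 1 - (\<Sum>a\<in>UNIV. h $ torus_index a * partial_deriv a v p))) (at (graph_param v p))"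
    unfolding graph_defining_fun_def[abs_def]
    by (intro has_derivative_diff bounded_linear_imp_has_derivative[OF bounded_linear_vec_nth]) simp
  from fun_cong[OF frechet_derivative_at[OF this], of h] show ?thesis by simp
qed

text \<open>Pairing of the covariant derivative of the unit normal with a tangent vector:
  \<open>x1\<close>, \<open>xa\<close>, \<open>xb\<close> are metric coefficients,
  \<open>y1\<close>, \<open>ya\<close>, \<open>yb\<close> their height derivatives,
  \<open>Da\<close>, \<open>Db\<close> slopes, \<open>m\<close> a second derivative,
  \<open>e\<close> the Kronecker delta, \<open>l\<close> the conormal length and \<open>ra\<close> a
  derivative of \<open>1 / l\<close>. The \<open>ra\<close> terms cancel because a change of length
  moves a normal along itself, orthogonally to tangent vectors.\<close>

lemma second_fundamental_form_algebra:
  fixes x1 xa xb l y1 ya yb ra Da Db m e :: real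
  assumes "x1 \<noteq> 0" "xa \<noteq> 0" "xb \<noteq> 0" "l \<noteq> 0"
  shows "x1 * (ra / x1 - 1 / l * (y1 * Da) / x1\<^sup>2
      + (y1 * (Da * (1 / (x1 * l)) + Da * (1 / (x1 * l)))
         - (y1 * Da * (1 / (x1 * l)) + ya * (- (Da / (xa * l))))) / (2 * x1)) * Db
      + xb * (- (ra * Db / xb + 1 / l * m / xb - 1 / l * Db * (yb * Da) / xb\<^sup>2)
      + (yb * (Da * (- (Db / (xb * l))) + e * (1 / (x1 * l)))) / (2 * xb))
     = (- m + Da * Db / 2 * (ya / xa + yb / xb - y1 / x1) + e * yb / (2 * x1)) / l"
    (is "?L = ?R")
proof -
  have "?L - ?R = 0" using assms
    by (simp add: diff_divide_distrib add_divide_distrib ring_distribs power2_eq_square)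
  then show ?thesis by simp
qed

text \<open>Positivity and differentiability are asked only at heights attained by the graph, since
  the geon coefficient of the \<xi>-circle vanishes at height 0.\<close>

locale diag_metric_graph =
  fixes g g' :: "4 \<Rightarrow> real \<Rightarrow> real" and v :: "real^3 \<Rightarrow> real"
  assumes smooth: "smooth_map v"
    and pos: "0 < g k (v p)"
    and deriv: "(g k has_real_derivative g' k (v p)) (at (v p))"
begin

abbreviation "D a p \<equiv> partial_deriv a v p"
abbreviation "gt a p \<equiv> g (torus_index a) (v p)"
abbreviation "gt' a p \<equiv> g' (torus_index a) (v p)"

text \<open>The length of the differential of \<open>graph_defining_fun v\<close>. The field
  \<open>normal\<close> is the metric dual of this differential divided by its length.\<close>

definition "conormal_length p = sqrt (1 / g 1 (v p) + (\<Sum>a\<in>UNIV. (D a p)\<^sup>2 / gt a p))"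

definition normal :: "real^3 \<Rightarrow> real^4" where
  "normal p = (1 / (g 1 (v p) * conormal_length p)) *\<^sub>R axis 1 1
   - (\<Sum>a\<in>UNIV. (D a p / (gt a p * conormal_length p)) *\<^sub>R axis (torus_index a) 1)"

lemma neq0 [simp]: "g k (v p) \<noteq> 0"
  using pos[of k p] by simp

lemma conormal_length_sq:
  "(conormal_length p)\<^sup>2 = 1 / g 1 (v p) + (\<Sum>a\<in>UNIV. (D a p)\<^sup>2 / gt a p)"
  and conormal_length_pos: "0 < conormal_length p"
proof -
  have "0 < 1 / g 1 (v p) + (\<Sum>a\<in>UNIV. (D a p)\<^sup>2 / gt a p)"
    by (intro add_pos_nonneg sum_nonneg divide_nonneg_pos) (auto simp: pos)
  then show "(conormal_length p)\<^sup>2 = 1 / g 1 (v p) + (\<Sum>a\<in>UNIV. (D a p)\<^sup>2 / gt a p)"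
    "0 < conormal_length p" by (auto simp: conormal_length_def)
qed

lemma normal_nth:
  "normal p $ 1 = 1 / (g 1 (v p) * conormal_length p)"
  "normal p $ torus_index a = - (D a p / (gt a p * conormal_length p))"
  by (simp_all add: normal_def axis_def mult_delta_right cong: if_cong)

lemma v_differentiable: "v differentiable (at p)"
  by (rule smooth_map_differentiable[OF smooth])

lemma partial_deriv_graph_param_nth:
  "partial_deriv a (graph_param v) p $ 1 = D a p"
  "partial_deriv a (graph_param v) p $ torus_index b = (if a = b then 1 else 0)"
  by (auto simp: partial_deriv_graph_param[OF v_differentiable] axis_def)

lemma inner_tangent:
  "metric_inner (diag_metric g) (graph_param v p) X (partial_deriv b (graph_param v) p)
    = g 1 (v p) * X $ 1 * D b p + gt b p * X $ torus_index b"
  by (simp add: metric_inner_diag sum_torus_index partial_deriv_graph_param_nth mult_delta_right)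

text \<open>For uniqueness, orthogonality to the tangent vectors determines the torus components
  from \<open>N $ 1\<close>, unit length determines \<open>N $ 1\<close> up to sign, and the outward
  condition selects the positive sign.\<close>

lemma outward_unit_normal_eq:
  "outward_unit_normal (diag_metric g) (graph_param v) (graph_defining_fun v) p = normal p"
  unfolding outward_unit_normal_def
proof (rule the_equality)
  let ?l = "conormal_length p"
  note l = conormal_length_pos[of p]
  have "metric_inner (diag_metric g) (graph_param v p) (normal p) (normal p)
     = (1 / g 1 (v p) + (\<Sum>a\<in>UNIV. (D a p)\<^sup>2 / gt a p)) / ?l\<^sup>2"
    using l by (simp add: metric_inner_diag sum_torus_index normal_nth sum_divide_distrib
        power2_eq_square add_divide_distrib mult_ac)
  moreover have "frechet_derivative (graph_defining_fun v) (at (graph_param v p)) (normal p)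
     = (1 / g 1 (v p) + (\<Sum>a\<in>UNIV. (D a p)\<^sup>2 / gt a p)) / ?l"
    by (simp add: graph_defining_fun_derivative[OF v_differentiable] normal_nth sum_divide_distrib
        power2_eq_square add_divide_distrib sum_negf mult_ac)
  ultimately show "metric_inner (diag_metric g) (graph_param v p) (normal p) (normal p) = 1 \<and>
    (\<forall>a. metric_inner (diag_metric g) (graph_param v p) (normal p) (partial_deriv a (graph_param v) p) = 0) \<and>
    0 < frechet_derivative (graph_defining_fun v) (at (graph_param v p)) (normal p)"
    using l unfolding conormal_length_sq[symmetric]
    by (auto simp: inner_tangent normal_nth power2_eq_square)
next
  fix N
  let ?l = "conormal_length p" and ?g = "g 1 (v p)"
  note l = conormal_length_pos[of p] and g1 = pos[of 1 p]
  assume N: "metric_inner (diag_metric g) (graph_param v p) N N = 1 \<and>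
    (\<forall>a. metric_inner (diag_metric g) (graph_param v p) N (partial_deriv a (graph_param v) p) = 0) \<and>
    0 < frechet_derivative (graph_defining_fun v) (at (graph_param v p)) N"
  then have t: "N $ torus_index a = - (?g * N $ 1 * D a p / gt a p)" for a
    by (simp add: inner_tangent field_simps eq_neg_iff_add_eq_0)
  have s: "(\<Sum>a\<in>UNIV. (D a p)\<^sup>2 / gt a p) = ?l\<^sup>2 - 1 / ?g"
    by (simp add: conormal_length_sq)
  have "1 = ?g * (N $ 1)\<^sup>2 + (\<Sum>a\<in>UNIV. (?g * N $ 1)\<^sup>2 * ((D a p)\<^sup>2 / gt a p))"
    using N by (simp add: metric_inner_diag sum_torus_index t power2_eq_square mult_ac)
  also have "\<dots> = (?g * ?l * N $ 1)\<^sup>2"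
    unfolding sum_distrib_left[symmetric] s by (simp add: field_simps power2_eq_square)
  finally have sq: "(?g * ?l * N $ 1)\<^sup>2 = 1" ..
  have "0 < N $ 1 + (\<Sum>a\<in>UNIV. ?g * N $ 1 * ((D a p)\<^sup>2 / gt a p))"
    using N by (simp add: graph_defining_fun_derivative[OF v_differentiable] t sum_negf power2_eq_square mult_ac)
  also have "\<dots> = ?l * (?g * ?l * N $ 1)"
    unfolding sum_distrib_left[symmetric] s by (simp add: field_simps power2_eq_square)
  finally have "0 < ?g * ?l * N $ 1" using l by (simp add: zero_less_mult_iff)
  with sq have "?g * ?l * N $ 1 = 1" by (simp add: power2_eq_1_iff)
  then have n1: "N $ 1 = 1 / (?g * ?l)" using l g1 by (simp add: field_simps)
  show "N = normal p"
    unfolding vec_eq_iff all_torus_index by (simp add: normal_nth t) (simp add: n1)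
qed

lemma second_fundamental_form_eq:
  "second_fundamental_form (diag_metric g) (graph_param v) (graph_defining_fun v) p $ a $ b =
    (- partial_deriv a (partial_deriv b v) p
     + D a p * D b p / 2 * (gt' a p / gt a p + gt' b p / gt b p - g' 1 (v p) / g 1 (v p))
     + (if a = b then gt' a p / (2 * g 1 (v p)) else 0)) / conormal_length p"
proof -
  let ?r = "\<lambda>p. 1 / conormal_length p"
  have v': "(v has_derivative (\<lambda>h. \<Sum>i\<in>UNIV. h $ i *\<^sub>R D i p)) (at p)"
    by (rule has_derivative_partial_derivs[OF v_differentiable])
  have D': "((\<lambda>p. D b p) has_derivative (\<lambda>h. \<Sum>i\<in>UNIV. h $ i *\<^sub>R partial_deriv i (partial_deriv b v) p)) (at p)" for b
    by (rule has_derivative_partial_derivs[OF smooth_map_differentiable[OF smooth_map_partial_deriv[OF smooth]]])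
  have g': "((\<lambda>p. g k (v p)) has_derivative (\<lambda>h. g' k (v p) * (\<Sum>i\<in>UNIV. h $ i *\<^sub>R D i p))) (at p)" for k
    using has_derivative_compose[OF v' deriv[unfolded has_field_derivative_def]] by simp
  \<comment> \<open>Existence suffices: the value of \<open>r'\<close> cancels in
    \<open>second_fundamental_form_algebra\<close>.\<close>
  have "\<exists>r'. (?r has_derivative r') (at p)"
  proof -
    let ?f = "\<lambda>p. 1 / g 1 (v p) + (\<Sum>a\<in>UNIV. (D a p)\<^sup>2 / gt a p)"
    have ne: "?f p > 0"
      using conormal_length_pos[of p] unfolding conormal_length_def by simp
    have dq: "\<exists>d. ((\<lambda>p. (D a p)\<^sup>2 / gt a p) has_derivative d) (at p)" for a
      unfolding power2_eq_square
      by (rule exI, (rule derivative_eq_intros g' D' refl neq0)+)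
    then obtain q where "((\<lambda>p. (D a p)\<^sup>2 / gt a p) has_derivative q a) (at p)" for a
      by metis
    moreover have "\<exists>d. ((\<lambda>p. 1 / g 1 (v p)) has_derivative d) (at p)"
      by (rule exI, (rule derivative_eq_intros g' refl neq0)+)
    then obtain r where "((\<lambda>p. 1 / g 1 (v p)) has_derivative r) (at p)" ..
    ultimately have d: "(?f has_derivative (\<lambda>h. r h + (\<Sum>a\<in>UNIV. q a h))) (at p)"
      by (intro has_derivative_add has_derivative_sum)
    have "((\<lambda>x. 1 / sqrt x) has_real_derivative - (1 / (2 * sqrt (?f p))) / (sqrt (?f p))\<^sup>2) (at (?f p))"
      using ne by (auto intro!: derivative_eq_intros simp: field_simps power2_eq_square)
    from has_derivative_compose[OF d this[unfolded has_field_derivative_def]]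
    show ?thesis unfolding conormal_length_def by blast
  qed
  then obtain r' where r': "(?r has_derivative r') (at p)" ..
  let ?ra = "r' (axis a 1)"
  have n1: "((\<lambda>p. normal p $ 1) has_derivative
      (\<lambda>h. r' h / g 1 (v p) - ?r p * (g' 1 (v p) * (\<Sum>i\<in>UNIV. h $ i *\<^sub>R D i p)) / (g 1 (v p))\<^sup>2)) (at p)"
  proof -
    have "((\<lambda>p. ?r p / g 1 (v p)) has_derivative
      (\<lambda>h. r' h / g 1 (v p) - ?r p * (g' 1 (v p) * (\<Sum>i\<in>UNIV. h $ i *\<^sub>R D i p)) / (g 1 (v p))\<^sup>2)) (at p)"
      by (rule derivative_eq_intros r' g' refl neq0)+ (simp add: field_simps power2_eq_square)
    then show ?thesis by (simp add: normal_nth mult.commute)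
  qed
  have nb: "((\<lambda>p. normal p $ torus_index b) has_derivative
      (\<lambda>h. - (r' h * D b p / gt b p + ?r p * (\<Sum>i\<in>UNIV. h $ i *\<^sub>R partial_deriv i (partial_deriv b v) p) / gt b p
         - ?r p * D b p * (gt' b p * (\<Sum>i\<in>UNIV. h $ i *\<^sub>R D i p)) / (gt b p)\<^sup>2))) (at p)" for b
  proof -
    have "((\<lambda>p. - (?r p * D b p / gt b p)) has_derivative
      (\<lambda>h. - (r' h * D b p / gt b p + ?r p * (\<Sum>i\<in>UNIV. h $ i *\<^sub>R partial_deriv i (partial_deriv b v) p) / gt b p
         - ?r p * D b p * (gt' b p * (\<Sum>i\<in>UNIV. h $ i *\<^sub>R D i p)) / (gt b p)\<^sup>2))) (at p)"
      by (rule derivative_eq_intros r' g' D' refl neq0)+ (simp add: field_simps power2_eq_square)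
    then show ?thesis by (simp add: normal_nth mult.commute)
  qed
  have nd: "normal differentiable (at p)"
  proof -
    have "\<forall>k. (\<lambda>p. normal p $ k) differentiable (at p)"
      unfolding all_torus_index by (intro conjI allI differentiableI[OF n1] differentiableI[OF nb])
    then show ?thesis
      by (subst differentiable_componentwise_within) (auto simp: Basis_vec_def inner_axis)
  qed
  have e: "(\<Sum>i\<in>UNIV. axis a 1 $ i *\<^sub>R F i) = F a" for F :: "3 \<Rightarrow> real"
    by (simp add: axis_def mult_delta_left)
  have d1: "partial_deriv a normal p $ 1 = ?ra / g 1 (v p) - ?r p * (g' 1 (v p) * D a p) / (g 1 (v p))\<^sup>2"
    unfolding partial_deriv_vec_nth[OF nd] partial_deriv_eqI[OF n1] e ..
  have db: "partial_deriv a normal p $ torus_index b = - (?ra * D b p / gt b p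
      + ?r p * partial_deriv a (partial_deriv b v) p / gt b p - ?r p * D b p * (gt' b p * D a p) / (gt b p)\<^sup>2)"
    unfolding partial_deriv_vec_nth[OF nd] partial_deriv_eqI[OF nb] e ..
  have o: "outward_unit_normal (diag_metric g) (graph_param v) (graph_defining_fun v) = normal"
    using outward_unit_normal_eq by blast
  \<comment> \<open>The sum subtracted for \<open>k = 1\<close> has two terms, because the
    \<open>a\<close>-th tangent vector has components only along the height and along
    \<open>torus_index a\<close>.\<close>
  have c: "covariant_deriv (diag_metric g) (graph_param v) normal a p $ k =
     partial_deriv a normal p $ k +
      (g' k (v p) * (D a p * normal p $ k + partial_deriv a (graph_param v) p $ k * normal p $ 1)
       - (if k = 1 then g' 1 (v p) * D a p * normal p $ 1 + gt' a p * normal p $ torus_index a else 0)) / (2 * g k (v p))" for k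
    using sum_christoffel_diag[of g "graph_param v p" "\<lambda>k. g' k (v p)" k]
    by (simp add: covariant_deriv_def deriv)
      (simp add: sum_torus_index partial_deriv_graph_param_nth mult_delta_left mult_delta_right)
  show ?thesis
    using conormal_length_pos[of p]
     second_fundamental_form_algebra[of "g 1 (v p)" "gt a p" "gt b p" "conormal_length p" ?ra "g' 1 (v p)" "D a p" "gt' a p" "D b p" "partial_deriv a (partial_deriv b v) p" "gt' b p" "if a = b then 1 else 0"]
    unfolding second_fundamental_form_def o
    by (simp add: inner_tangent c d1 db normal_nth partial_deriv_graph_param_nth del: times_divide_eq_right times_divide_eq_left)
qed

end

section \<open>Integration over the torus\<close>

text \<open>One coordinate direction of the divergence theorem on a torus. By periodicity the
  integral of a translate of \<open>f\<close> over the cell does not depend on the translation;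
  differentiating under the integral sign at translation 0 gives the claim.\<close>

lemma integral_periodic_derivative:
  fixes f f' :: "'a::euclidean_space \<Rightarrow> real"
  assumes e: "e \<in> Basis" and P: "0 < P" "b \<bullet> e = a \<bullet> e + P"
    and per: "\<And>x. f (x + P *\<^sub>R e) = f x"
    and cont: "continuous_on UNIV f" "continuous_on UNIV f'"
    and der: "\<And>x t. ((\<lambda>t. f (x + t *\<^sub>R e)) has_real_derivative f' (x + t *\<^sub>R e)) (at t)"
  shows "integral (cbox a b) f' = 0"
proof -
  let ?I = "\<lambda>h. integral (cbox a b) (\<lambda>x. f (x + h *\<^sub>R e))"
  have const: "?I h = integral (cbox a b) f" if h: "h \<in> {0..P}" for h
  proof -
    \<comment> \<open>This box is cut in two ways: into the cell and a slab of width
      \<open>h\<close>, and into the translated cell and another slab of width \<open>h\<close>. The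
      two slabs differ by a full period.\<close>
    let ?T = "cbox a (b + h *\<^sub>R e)"
    have int: "f integrable_on ?T"
      using cont(1) continuous_on_subset integrable_continuous by blast
    have sets: "?T \<inter> {x. x \<bullet> e \<le> b \<bullet> e} = cbox a b"
      "?T \<inter> {x. b \<bullet> e \<le> x \<bullet> e} = cbox (a + P *\<^sub>R e) (b + h *\<^sub>R e)"
      "?T \<inter> {x. a \<bullet> e + h \<le> x \<bullet> e} = cbox (a + h *\<^sub>R e) (b + h *\<^sub>R e)"
      "?T \<inter> {x. x \<bullet> e \<le> a \<bullet> e + h} = cbox a (b + h *\<^sub>R e - P *\<^sub>R e)"
      using h P e by (fastforce simp: mem_box algebra_simps inner_Basis split: if_splits)+
    have "integral (cbox (a + h *\<^sub>R e) (b + h *\<^sub>R e)) f + integral (cbox a (b + h *\<^sub>R e - P *\<^sub>R e)) f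
       = integral (cbox a b) f + integral (cbox (a + P *\<^sub>R e) (b + h *\<^sub>R e)) f"
      using integral_split[OF int e, of "b \<bullet> e"] integral_split[OF int e, of "a \<bullet> e + h"]
      unfolding sets by simp
    moreover have "integral (cbox a (b + h *\<^sub>R e - P *\<^sub>R e)) f = integral (cbox (a + P *\<^sub>R e) (b + h *\<^sub>R e)) f"
      using integral_shift_cbox[of "a + P *\<^sub>R e" "P *\<^sub>R e" "b + h *\<^sub>R e" f] by (simp add: per)
    moreover have "?I h = integral (cbox (a + h *\<^sub>R e) (b + h *\<^sub>R e)) f"
      using integral_shift_cbox[of "a + h *\<^sub>R e" "h *\<^sub>R e" "b + h *\<^sub>R e" f] by simp
    ultimately show ?thesis by simp
  qed
  \<comment> \<open>Translations range over \<open>{0..P}\<close>, so the derivative at 0 is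
    one-sided; it is still unique on this nondegenerate interval.\<close>
  have "(?I has_real_derivative integral (cbox a b) (\<lambda>x. f' (x + 0 *\<^sub>R e))) (at 0 within {0..P})"
  proof (rule leibniz_rule_field_derivative)
    show "((\<lambda>h. f (t + h *\<^sub>R e)) has_real_derivative f' (t + h *\<^sub>R e)) (at h within {0..P})" for h t
      using der by (rule DERIV_subset) simp
    show "(\<lambda>x. f (x + h *\<^sub>R e)) integrable_on cbox a b" for h
      by (intro integrable_continuous continuous_on_compose2[OF cont(1)] continuous_intros) auto
    show "continuous_on ({0..P} \<times> cbox a b) (\<lambda>(h, x). f' (x + h *\<^sub>R e))"
      unfolding case_prod_beta
      by (intro continuous_on_compose2[OF cont(2)] continuous_intros) auto
  qed (use P in auto)
  then have I: "(?I has_vector_derivative integral (cbox a b) f') (at 0 within {0..P})"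
    unfolding has_real_derivative_iff_has_vector_derivative scaleR_zero_left add_0_right .
  have "((\<lambda>h. integral (cbox a b) f) has_vector_derivative integral (cbox a b) f') (at 0 within {0..P})"
  proof (rule has_vector_derivative_transform[OF _ _ I])
    show "0 \<in> {0..P}" using P(1) by simp
  qed (rule const[symmetric])
  then have "((\<lambda>h. integral (cbox a b) f) has_vector_derivative integral (cbox a b) f') (at 0 within cbox 0 P)"
    by simp
  then show ?thesis
    using vector_derivative_unique_within_closed_interval[of 0 P 0, OF _ _ _ has_vector_derivative_const] P(1) by auto
qed

section \<open>Lebesgue measure on the chart and on the period cell\<close>

lemma prod_Basis_vec:
  fixes h :: "real^'n \<Rightarrow> 'b::comm_monoid_mult"
  shows "(\<Prod>b\<in>Basis. h b) = (\<Prod>i\<in>UNIV. h (axis i 1))"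
proof -
  have *: "(Basis :: (real^'n) set) = range (\<lambda>i. axis i 1)"
    by (auto simp: Basis_vec_def)
  have inj: "inj (\<lambda>i::'n. axis i (1::real))"
    by (simp add: inj_on_def axis_eq_axis)
  show ?thesis
    using prod.reindex[OF inj, of h] unfolding * comp_def .
qed

lemma prod_torus_index:
  "(\<Prod>k\<in>(UNIV::4 set). F k) = F 1 * (\<Prod>a\<in>UNIV. F (torus_index a))"
  unfolding UNIV_4 UNIV_3 by (simp add: mult_ac)

lemma prod_UNIV_3: "(\<Prod>a\<in>(UNIV::3 set). F a) = F 1 * F 2 * F 3"
  unfolding UNIV_3 by (simp add: mult_ac)

text \<open>Lebesgue measure is characterised by the volume of boxes, and a box pulls back to an
  interval times a box. This makes Fubini along the height available; the constant height function
  turns \<open>graph_param\<close> into the coordinate map.\<close>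

lemma lborel_eq_distr_torus_fibres:
  "(lborel :: (real^4) measure)
    = distr (lborel \<Otimes>\<^sub>M lborel) borel (\<lambda>(s, p). graph_param (\<lambda>_. s) p)"
proof (rule lborel_eqI)
  let ?\<psi> = "\<lambda>(s, p). graph_param (\<lambda>_. s) p"
  have "continuous_on UNIV ?\<psi>"
    unfolding graph_param_eq[abs_def] case_prod_beta by (intro continuous_intros)
  then have m: "?\<psi> \<in> borel_measurable (lborel \<Otimes>\<^sub>M lborel)"
    by (simp add: lborel_prod borel_measurable_continuous_onI)
  fix l u :: "real^4"
  assume le: "\<And>b. b \<in> Basis \<Longrightarrow> l \<bullet> b \<le> u \<bullet> b"
  have le': "l $ k \<le> u $ k" for k
    using le[of "axis k 1"] by (simp add: inner_axis)
  have "?\<psi> -` box l u \<inter> space (lborel \<Otimes>\<^sub>M lborel) = box (l $ 1) (u $ 1) \<times> box (torus_part l) (torus_part u)"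
    by (auto simp: mem_box_cart all_torus_index space_pair_measure)
  moreover have "torus_part l \<bullet> b \<le> torus_part u \<bullet> b" if "b \<in> Basis" for b
    using that le' by (auto simp: Basis_vec_def inner_axis)
  ultimately show "emeasure (distr (lborel \<Otimes>\<^sub>M lborel) borel ?\<psi>) (box l u) = (\<Prod>b\<in>Basis. (u - l) \<bullet> b)"
    using m le'
    by (simp add: emeasure_distr lborel.emeasure_pair_measure_Times emeasure_lborel_box
        prod_Basis_vec inner_axis prod_torus_index ennreal_mult' prod_nonneg)
qed simp

definition torus_top :: "real \<Rightarrow> real \<Rightarrow> real^3" where
  "torus_top a3 a4 = vector [pi, a3, a4]"

lemma torus_top_pos: "0 < a3 \<Longrightarrow> 0 < a4 \<Longrightarrow> 0 < torus_top a3 a4 $ i"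
  using exhaust_3[of i] by (auto simp: torus_top_def)

lemma torus_cell_bounds:
  "box 0 (torus_top a3 a4) \<subseteq> torus_cell a3 a4" "torus_cell a3 a4 \<subseteq> cbox 0 (torus_top a3 a4)"
  by (auto simp: torus_cell_def torus_top_def mem_box_cart forall_3)

lemma sets_torus_cell [measurable]: "torus_cell a3 a4 \<in> sets borel"
proof -
  have [measurable]: "(\<lambda>p::real^3. p $ a) \<in> borel_measurable borel" for a
    by (intro borel_measurable_continuous_onI continuous_intros)
  have "torus_cell a3 a4 = {p \<in> space borel. p$1 \<in> {0..<pi} \<and> p$2 \<in> {0..<a3} \<and> p$3 \<in> {0..<a4}}"
    by (simp add: torus_cell_def)
  also have "\<dots> \<in> sets borel" by measurable
  finally show ?thesis .
qed

lemma set_integrable_torus_cell: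
  fixes f :: "real^3 \<Rightarrow> real"
  assumes "continuous_on UNIV f"
  shows "set_integrable lborel (torus_cell a3 a4) f"
proof -
  have "set_integrable lborel (cbox 0 (torus_top a3 a4)) f"
    unfolding set_integrable_def using assms
    by (intro borel_integrable_compact) (auto intro: continuous_on_subset)
  then show ?thesis
    by (rule set_integrable_subset) (use torus_cell_bounds in auto)
qed

text \<open>The half-open cell and the closed box differ by part of the box's frontier, a null
  set.\<close>

lemma LINT_torus_cell:
  fixes f :: "real^3 \<Rightarrow> real"
  assumes "continuous_on UNIV f"
  shows "(LINT p:torus_cell a3 a4|lborel. f p) = integral (cbox 0 (torus_top a3 a4)) f"
proof -
  have "(LINT p:torus_cell a3 a4|lborel. f p) = integral (torus_cell a3 a4) f"
    by (rule set_borel_integral_eq_integral[OF set_integrable_torus_cell[OF assms]])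
  also have "\<dots> = integral (cbox 0 (torus_top a3 a4)) f"
  proof (rule integral_spike_set)
    show "negligible {x \<in> torus_cell a3 a4 - cbox 0 (torus_top a3 a4). f x \<noteq> 0}"
      by (rule negligible_subset[OF negligible_empty]) (use torus_cell_bounds(2)[of a3 a4] in blast)
    show "negligible {x \<in> cbox 0 (torus_top a3 a4) - torus_cell a3 a4. f x \<noteq> 0}"
      by (rule negligible_subset[OF negligible_frontier_interval[of 0 "torus_top a3 a4"]])
        (use torus_cell_bounds(1)[of a3 a4] in blast)
  qed
  finally show ?thesis .
qed

text \<open>Fubini over the vertical fibres, followed by the fundamental theorem of calculus from
  the core to the graph.\<close>

lemma LINT_enclosed_region:
  assumes v: "continuous_on UNIV v" "\<And>p. 0 \<le> v p"
    and F: "\<And>s. (F has_real_derivative f s) (at s)" and f: "continuous_on UNIV f"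
  shows "(LINT x:enclosed_region a3 a4 v|lborel. f (x$1))
    = (LINT p:torus_cell a3 a4|lborel. F (v p) - F 0)"
proof -
  let ?C = "torus_cell a3 a4" and ?K = "cbox 0 (torus_top a3 a4)"
  let ?\<psi> = "\<lambda>(s, p). graph_param (\<lambda>_. s) p"
  let ?h = "\<lambda>s p. indicator ?C p * (f s * indicator {0..<v p} s) :: real"
  have [measurable]: "v \<in> borel_measurable borel" "f \<in> borel_measurable borel"
    using v f by (auto intro: borel_measurable_continuous_onI)
  have "continuous_on UNIV ?\<psi>"
    unfolding graph_param_eq[abs_def] case_prod_beta by (intro continuous_intros)
  then have m: "?\<psi> \<in> borel_measurable (lborel \<Otimes>\<^sub>M lborel)"
    by (simp add: lborel_prod borel_measurable_continuous_onI)
  have [measurable]: "(\<lambda>x::real^4. x $ k) \<in> borel_measurable borel" for k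
    by (intro borel_measurable_continuous_onI continuous_intros)
  have [measurable]: "torus_part \<in> borel_measurable borel"
    using bounded_linear_torus_part by (simp add: borel_measurable_continuous_onI linear_continuous_on)
  have R [measurable]: "enclosed_region a3 a4 v \<in> sets borel"
  proof -
    have "enclosed_region a3 a4 v = {x \<in> space borel. 0 \<le> x$1 \<and> x$1 < v (torus_part x) \<and> torus_part x \<in> ?C}"
      by (simp add: enclosed_region_def)
    also have "\<dots> \<in> sets borel" by measurable
    finally show ?thesis .
  qed
  have hm: "(\<lambda>(s, p). ?h s p) \<in> borel_measurable (lborel \<Otimes>\<^sub>M lborel)"
  proof -
    have "(\<lambda>(s, p). ?h s p) = (\<lambda>z. indicator ?C (snd z) * (f (fst z) * (if 0 \<le> fst z \<and> fst z < v (snd z) then 1 else 0)))"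
      by (auto simp: indicator_def)
    also have "\<dots> \<in> borel_measurable (lborel \<Otimes>\<^sub>M lborel)"
      by measurable
    finally show ?thesis .
  qed
  have "compact (v ` ?K)"
    using v by (intro compact_continuous_image) (auto intro: continuous_on_subset)
  then obtain M where M: "\<And>p. p \<in> ?K \<Longrightarrow> v p \<le> M"
    using compact_imp_bounded bounded_imp_bdd_above unfolding bdd_above_def by (metis image_eqI)
  have "compact (f ` {0..M})"
    using f by (intro compact_continuous_image) (auto intro: continuous_on_subset)
  then obtain B where "\<forall>y\<in>f ` {0..M}. norm y \<le> B"
    using compact_imp_bounded bounded_iff by blast
  then have B: "\<bar>f s\<bar> \<le> B" if "s \<in> {0..M}" for s
    using that by auto
  \<comment> \<open>The integrand is bounded by \<open>B\<close> and supported in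
    \<open>{0..M} \<times> ?K\<close>, where \<open>M\<close> bounds \<open>v\<close> on the closed
    cell.\<close>
  have int: "integrable (lborel \<Otimes>\<^sub>M lborel) (\<lambda>(s, p). ?h s p)"
  proof (rule integrableI_bounded_set[where A = "{0..M} \<times> ?K" and B = B])
    show "emeasure (lborel \<Otimes>\<^sub>M lborel) ({0..M} \<times> ?K) < \<infinity>"
      using emeasure_lborel_cbox_finite[of 0 "torus_top a3 a4"]
      by (simp add: lborel.emeasure_pair_measure_Times ennreal_mult_less_top emeasure_lborel_Icc_eq)
    have "(case z of (s, p) \<Rightarrow> ?h s p) = 0" if "z \<notin> {0..M} \<times> ?K" for z
      using that M[of "snd z"] torus_cell_bounds(2)[of a3 a4]
      by (cases z) (auto simp: indicator_def)
    then show "AE z in lborel \<Otimes>\<^sub>M lborel. z \<notin> {0..M} \<times> ?K \<longrightarrow> (case z of (s, p) \<Rightarrow> ?h s p) = 0"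
      by (intro AE_I2 impI)
    have "norm (case z of (s, p) \<Rightarrow> ?h s p) \<le> B" if "z \<in> {0..M} \<times> ?K" for z
    proof (cases z)
      case (Pair s p)
      then show ?thesis
        using that B[of s] abs_ge_zero[of "f s"] by (auto simp: indicator_def)
    qed
    then show "AE z in lborel \<Otimes>\<^sub>M lborel. z \<in> {0..M} \<times> ?K \<longrightarrow> norm (case z of (s, p) \<Rightarrow> ?h s p) \<le> B"
      by (intro AE_I2 impI)
  qed (use hm in auto)
  have "(LINT x:enclosed_region a3 a4 v|lborel. f (x$1))
      = (\<integral>z. indicator (enclosed_region a3 a4 v) (?\<psi> z) *\<^sub>R f (?\<psi> z $ 1) \<partial>(lborel \<Otimes>\<^sub>M lborel))"
    unfolding set_lebesgue_integral_def
    by (subst lborel_eq_distr_torus_fibres, subst integral_distr[OF m]) auto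
  also have "\<dots> = (\<integral>z. (case z of (s, p) \<Rightarrow> ?h s p) \<partial>(lborel \<Otimes>\<^sub>M lborel))"
    by (intro Bochner_Integration.integral_cong) (auto simp: enclosed_region_def indicator_def)
  also have "\<dots> = (\<integral>p. (\<integral>s. ?h s p \<partial>lborel) \<partial>lborel)"
    using lborel_pair.integral_snd[OF int] by simp
  also have "\<dots> = (\<integral>p. indicator ?C p *\<^sub>R (F (v p) - F 0) \<partial>lborel)"
  proof (intro Bochner_Integration.integral_cong refl)
    fix p
    \<comment> \<open>The region excludes its top point; adding it changes a null set and yields a
      closed interval.\<close>
    have "(\<integral>s. f s * indicator {0..<v p} s \<partial>lborel) = (\<integral>s. f s * indicator {0..v p} s \<partial>lborel)"
    proof (rule integral_cong_AE)
      show "AE s in lborel. f s * indicator {0..<v p} s = f s * indicator {0..v p} s"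
        using AE_lborel_singleton[of "v p"] by eventually_elim (auto simp: indicator_def)
    qed simp_all
    also have "\<dots> = F (v p) - F 0"
      proof (rule integral_FTC_Icc_real)
      show "isCont f s" for s
        using f by (simp add: continuous_on_eq_continuous_at)
    qed (rule v F)+
    finally show "(\<integral>s. ?h s p \<partial>lborel) = indicator ?C p *\<^sub>R (F (v p) - F 0)"
      by simp
  qed
  finally show ?thesis unfolding set_lebesgue_integral_def .
qed

section \<open>The geon\<close>

definition geon_coeff :: "4 \<Rightarrow> real \<Rightarrow> real" where
  "geon_coeff k s = (if k = 1 then 1 else if k = 2 then (sinh (2 * s))\<^sup>2 / cosh (2 * s) else cosh (2 * s))"

definition geon_coeff' :: "4 \<Rightarrow> real \<Rightarrow> real" where
  "geon_coeff' k s = (if k = 1 then 0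
     else if k = 2 then 2 * sinh (2 * s) * ((cosh (2 * s))\<^sup>2 + 1) / (cosh (2 * s))\<^sup>2
     else 2 * sinh (2 * s))"

lemma geon_coeff_derivative: "(geon_coeff k has_real_derivative geon_coeff' k s) (at s)"
proof -
  have "((\<lambda>s. (sinh (2 * s))\<^sup>2 / cosh (2 * s)) has_real_derivative
      2 * sinh (2 * s) * ((cosh (2 * s))\<^sup>2 + 1) / (cosh (2 * s))\<^sup>2) (at s)"
    using hyperbolic_pythagoras[of "2 * s"]
    by (auto intro!: derivative_eq_intros simp: field_simps power2_eq_square) algebra
  moreover have "((\<lambda>s. cosh (2 * s)) has_real_derivative 2 * sinh (2 * s)) (at s)"
    by (auto intro!: derivative_eq_intros)
  ultimately show ?thesis
    by (cases "k = 1"; cases "k = 2") (simp_all add: geon_coeff_def[abs_def] geon_coeff'_def)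
qed

lemma geon_phi_sq: "(geon_phi s)\<^sup>2 = cosh (2 * s)"
  by (simp add: geon_phi_def)

lemma geon_phi_pos: "0 < geon_phi s"
  by (simp add: geon_phi_def)

lemma deriv_geon_phi: "deriv geon_phi s = sinh (2 * s) / geon_phi s"
proof (rule DERIV_imp_deriv)
  show "(geon_phi has_real_derivative sinh (2 * s) / geon_phi s) (at s)"
    unfolding geon_phi_def[abs_def] using cosh_real_pos[of "2 * s"]
    by (auto intro!: derivative_eq_intros simp: field_simps simp del: cosh_real_pos)
qed

lemma geon_metric_eq_diag: "geon_metric = diag_metric geon_coeff"
  by (simp add: fun_eq_iff vec_eq_iff geon_metric_def diag_metric_def geon_coeff_def geon_phi_sq
      deriv_geon_phi power_divide)

text \<open>The factor \<open>geon_phi s * deriv geon_phi s\<close> equals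
  \<open>sinh (2 * s)\<close>.\<close>

lemma conformal_geon_metric_eq_diag:
  "conformal_geon_metric = diag_metric (\<lambda>k s. (sinh (2 * s))\<^sup>2 * geon_coeff k s)"
  using geon_phi_pos
  by (simp add: fun_eq_iff vec_eq_iff conformal_geon_metric_def deriv_geon_phi geon_metric_eq_diag
      diag_metric_def less_imp_neq[symmetric])

text \<open>Trace of the second fundamental form without its factor \<open>1 / W\<close>:
  \<open>C\<close>, \<open>u\<close> are the hyperbolic functions, \<open>x\<close>,
  \<open>y\<close> the slopes and \<open>m22\<close> to \<open>m33\<close> the second derivatives.
  After clearing denominators it is a polynomial identity modulo the relations for
  \<open>u\<^sup>2\<close> and \<open>k\<close>.\<close>

lemma mean_curvature_algebra:
  fixes C u k x y m22 m23 m32 m33 :: real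
  assumes nz: "C \<noteq> 0" "u \<noteq> 0" "k \<noteq> 0" and u: "u\<^sup>2 = C\<^sup>2 - 1" and k: "k = C + (x\<^sup>2 + y\<^sup>2)"
  shows "C / u\<^sup>2 * (u * (C\<^sup>2 + 1) / C\<^sup>2)
      + (1 / C - x * x / (C * k)) * (- m22 + 2 * u / C * (x * x) + u)
      + - (x * y / (C * k)) * (- m23 + 2 * u / C * (x * y))
      + - (y * x / (C * k)) * (- m32 + 2 * u / C * (y * x))
      + (1 / C - y * y / (C * k)) * (- m33 + 2 * u / C * (y * y) + u)
      = (3 * C\<^sup>2 - 1 + u * (- (m22 + m33) + u * (x\<^sup>2 + y\<^sup>2) / k
          + (m22 * x\<^sup>2 + (m23 + m32) * (x * y) + m33 * y\<^sup>2) / k)) / (u * C)" (is "?L = ?R")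
proof -
  have "?L * (u * C * C * k) = ?R * (u * C * C * k)"
  proof -
    have 1: "C / u\<^sup>2 * (u * (C\<^sup>2 + 1) / C\<^sup>2) * (u * C * C * k) = C * k * (C\<^sup>2 + 1)"
      using nz by (simp add: power2_eq_square)
    have 2: "(1 / C - x * x / (C * k)) * (- m + 2 * u / C * (x * x) + u) * (u * C * C * k)
       = u * (k - x * x) * (C * (u - m) + 2 * u * (x * x))" for x m
      using nz by (simp add: field_simps)
    have 3: "- (x * y / (C * k)) * (- m + 2 * u / C * (x * y)) * (u * C * C * k)
       = - u * (x * y) * (2 * u * (x * y) - C * m)" for x y m
      using nz by (simp add: field_simps)
    have 4: "?R * (u * C * C * k) = C * (k * (3 * C\<^sup>2 - 1 - u * (m22 + m33)) + u * (u * (x\<^sup>2 + y\<^sup>2)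
          + (m22 * x\<^sup>2 + (m23 + m32) * (x * y) + m33 * y\<^sup>2)))"
      using nz by (simp add: field_simps)
    show ?thesis
      unfolding distrib_right[of _ _ "u * C * C * k"] 1 2 3 4 using u k by algebra
  qed
  moreover have "u * C * C * k \<noteq> 0" using nz by simp
  ultimately show ?thesis using mult_right_cancel by blast
qed

text \<open>Here \<open>Q\<close> is the squared slope, \<open>L\<close> the Laplacian and
  \<open>T\<close> the Hessian on the gradient. The left side is the slope-dependent part of the
  density of \<open>\<phi> H\<close>; the right side is the excess minus the divergence of the
  flux.\<close>

lemma excess_algebra:
  fixes C u W L T :: real
  assumes pos: "0 < C" "0 < u" "1 \<le> W" and u: "u\<^sup>2 = C\<^sup>2 - 1" and Q: "Q = C * (W\<^sup>2 - 1)"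
  shows "u * (- L + u * Q / (C * W\<^sup>2) + T / (C * W\<^sup>2))
    = u / (C * W * (W + 1)) * ((- (Q * L - T) + (2 * C\<^sup>2 / u + u) * Q)
        + (- T + (2 * C / u + 2 * u / C) * Q\<^sup>2 + (2 * C\<^sup>2 / u + u) * Q) / W\<^sup>2)
      + (3 * C\<^sup>2 - 1) * (W - 1)\<^sup>2 / W
      - (2 * C * Q / W + u * L / W - u / W ^ 3 * (T / C - Q\<^sup>2 * u / C\<^sup>2))"
proof -
  have nz: "C \<noteq> 0" "u \<noteq> 0" "W \<noteq> 0" "W + 1 \<noteq> 0" using pos by auto
  \<comment> \<open>Since \<open>Q\<close> contains the factor \<open>W\<^sup>2 - 1\<close>, the
    denominator \<open>W + 1\<close> cancels here and in \<open>QW2\<close>.\<close>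
  have QW: "Q / (C * W * (W + 1)) = (W - 1) / W"
    unfolding Q using nz by (simp add: divide_simps) (simp add: algebra_simps power2_eq_square)
  have QW2: "Q\<^sup>2 / (C * W * (W + 1)) = C * (W - 1)\<^sup>2 * (W + 1) / W"
    unfolding Q using nz by (simp add: divide_simps) (simp add: algebra_simps power2_eq_square)
  have "u * (2 * C\<^sup>2 / u + u) = 2 * C\<^sup>2 + u\<^sup>2" "u * (2 * C / u + 2 * u / C) = (2 * C\<^sup>2 + 2 * u\<^sup>2) / C"
    using nz by (simp_all add: field_simps power2_eq_square)
  then have u1: "u * (2 * C\<^sup>2 / u + u) = 3 * C\<^sup>2 - 1" "u * (2 * C / u + 2 * u / C) = (4 * C\<^sup>2 - 2) / C"
    unfolding u by simp_all
  \<comment> \<open>Collects the terms by \<open>Q\<close>, \<open>Q\<^sup>2\<close> and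
    \<open>T\<close>, so that the quotients just computed apply.\<close>
  have expand: "u / K * ((- (Q * L - T) + \<alpha> * Q) + (- T + \<beta> * Q\<^sup>2 + \<alpha> * Q) / W\<^sup>2)
     = (u * \<alpha> - u * L + u * \<alpha> / W\<^sup>2) * (Q / K) + u * \<beta> / W\<^sup>2 * (Q\<^sup>2 / K)
       + u * T * (1 - 1 / W\<^sup>2) / K" for K \<alpha> \<beta>
    by (simp add: add_divide_distrib diff_divide_distrib algebra_simps)
  have "u / (C * W * (W + 1)) * ((- (Q * L - T) + (2 * C\<^sup>2 / u + u) * Q)
        + (- T + (2 * C / u + 2 * u / C) * Q\<^sup>2 + (2 * C\<^sup>2 / u + u) * Q) / W\<^sup>2)
     = (u * (2 * C\<^sup>2 / u + u) - u * L + u * (2 * C\<^sup>2 / u + u) / W\<^sup>2) * (Q / (C * W * (W + 1)))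
       + u * (2 * C / u + 2 * u / C) / W\<^sup>2 * (Q\<^sup>2 / (C * W * (W + 1)))
       + u * T * (1 - 1 / W\<^sup>2) / (C * W * (W + 1))"
    by (rule expand)
  also have "\<dots> = (3 * C\<^sup>2 - 1 - u * L + (3 * C\<^sup>2 - 1) / W\<^sup>2) * ((W - 1) / W)
       + (4 * C\<^sup>2 - 2) / C / W\<^sup>2 * (C * (W - 1)\<^sup>2 * (W + 1) / W)
       + u * T * (W - 1) / (C * W ^ 3)"
  proof -
    have "u * T * (1 - 1 / W\<^sup>2) / (C * W * (W + 1)) = u * T * (W - 1) / (C * W ^ 3)"
      using nz by (simp add: divide_simps) (simp add: algebra_simps power2_eq_square power3_eq_cube)
    then show ?thesis unfolding QW QW2 u1 by simp
  qed
  finally have 1: "u / (C * W * (W + 1)) * ((- (Q * L - T) + (2 * C\<^sup>2 / u + u) * Q)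
        + (- T + (2 * C / u + 2 * u / C) * Q\<^sup>2 + (2 * C\<^sup>2 / u + u) * Q) / W\<^sup>2) = \<dots>" .
  have uu: "u * u = C * C - 1" "u * (u * z) = (C * C - 1) * z" for z
    using u by (simp_all add: power2_eq_square flip: mult.assoc)
  show ?thesis
    unfolding 1 Q using nz
    by (simp add: divide_simps) (simp add: algebra_simps power2_eq_square power3_eq_cube uu)
qed

text \<open>Positivity keeps the graph away from the core, where the metrics degenerate;
  \<open>D1\<close> is the infinitesimal form of \<xi>-symmetry.\<close>

locale geon_graph =
  fixes v :: "real^3 \<Rightarrow> real"
  assumes smooth: "smooth_map v" and v_pos: "0 < v p" and D1 [simp]: "partial_deriv 1 v p = 0"
begin

abbreviation "c p \<equiv> cosh (2 * v p)"
abbreviation "u p \<equiv> sinh (2 * v p)"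
abbreviation "D a p \<equiv> partial_deriv a v p"
abbreviation "DD a b p \<equiv> partial_deriv a (partial_deriv b v) p"
abbreviation "q p \<equiv> (D 2 p)\<^sup>2 + (D 3 p)\<^sup>2"

text \<open>Both the conormal length in the geon metric and the ratio of the area element of the
  graph to that of the coordinate torus at the same height.\<close>

definition "W p = sqrt (1 + q p / c p)"

lemma u_pos: "0 < u p" and c_pos: "0 < c p" and u_sq: "(u p)\<^sup>2 = (c p)\<^sup>2 - 1" and W_ge_1: "1 \<le> W p"
  and W_sq: "(W p)\<^sup>2 = 1 + q p / c p"
proof -
  show "0 < u p" using v_pos[of p] by simp
  show c: "0 < c p" by simp
  show "(u p)\<^sup>2 = (c p)\<^sup>2 - 1" using hyperbolic_pythagoras[of "2 * v p"] by simp
  show "1 \<le> W p" using c by (simp add: W_def)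
  have "0 \<le> q p / c p" using c by simp
  then show "(W p)\<^sup>2 = 1 + q p / c p" unfolding W_def by (intro real_sqrt_pow2) linarith
qed

sublocale geon: diag_metric_graph geon_coeff geon_coeff' v
proof
  show "0 < geon_coeff k (v p)" for k p
    using u_pos[of p] by (simp add: geon_coeff_def)
qed (use smooth geon_coeff_derivative in auto)

sublocale conformal: diag_metric_graph "\<lambda>k s. (sinh (2 * s))\<^sup>2 * geon_coeff k s"
  "\<lambda>k s. 4 * sinh (2 * s) * cosh (2 * s) * geon_coeff k s + (sinh (2 * s))\<^sup>2 * geon_coeff' k s" v
proof
  show "0 < (u p)\<^sup>2 * geon_coeff k (v p)" for k p
    using u_pos[of p] geon.pos[of k p] by simp
  show "((\<lambda>s. (sinh (2 * s))\<^sup>2 * geon_coeff k s) has_real_derivative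
      4 * u p * c p * geon_coeff k (v p) + (u p)\<^sup>2 * geon_coeff' k (v p)) (at (v p))" for k p
    by (auto intro!: derivative_eq_intros geon_coeff_derivative)
qed (rule smooth)

text \<open>Up to the positive factor \<open>W / u\<close>, the part of the conformal second fundamental form
  tangent to the \<open>\<theta>\<close>-torus.\<close>

definition "S a b p = - DD a b p + (2 * c p / u p + 2 * u p / c p) * (D a p * D b p)
   + (if a = b then 2 * (c p)\<^sup>2 / u p + u p else 0)"

lemma conformal_form:
  assumes "a \<noteq> 1" "b \<noteq> 1"
  shows "second_fundamental_form conformal_geon_metric (graph_param v) (graph_defining_fun v) p $ a $ b
    = S a b p / conformal.conormal_length p"
proof -
  have t: "torus_index a \<noteq> 2" "torus_index b \<noteq> 2"
    using assms exhaust_3[of a] exhaust_3[of b] by auto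
  show ?thesis
    unfolding conformal_geon_metric_eq_diag conformal.second_fundamental_form_eq S_def
    using t u_pos[of p] c_pos[of p]
    by (simp add: geon_coeff_def geon_coeff'_def) (simp add: field_simps power2_eq_square)
qed

text \<open>Convexity is tested on vectors without \<xi>-component.\<close>

lemma S_nonneg:
  assumes "nonneg_definite (second_fundamental_form conformal_geon_metric (graph_param v) (graph_defining_fun v) p)"
  shows "0 \<le> S 2 2 p * x\<^sup>2 + (S 2 3 p + S 3 2 p) * (x * y) + S 3 3 p * y\<^sup>2"
proof -
  let ?h = "second_fundamental_form conformal_geon_metric (graph_param v) (graph_defining_fun v) p"
  let ?X = "vector [0, x, y] :: real^3" and ?l = "conformal.conormal_length p"
  have "0 \<le> ?X \<bullet> (?h *v ?X)" using assms by (simp add: nonneg_definite_def)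
  also have "?X \<bullet> (?h *v ?X) = (S 2 2 p * x\<^sup>2 + (S 2 3 p + S 3 2 p) * (x * y) + S 3 3 p * y\<^sup>2) / ?l"
    by (simp add: inner_vec_def matrix_vector_mult_def sum_3 conformal_form)
      (simp add: add_divide_distrib algebra_simps power2_eq_square)
  finally show ?thesis using conformal.conormal_length_pos[of p] by (simp add: zero_le_divide_iff)
qed

text \<open>The flat Hessian of \<open>v\<close> evaluated on its gradient.\<close>

definition "T p = DD 2 2 p * (D 2 p)\<^sup>2 + (DD 2 3 p + DD 3 2 p) * (D 2 p * D 3 p) + DD 3 3 p * (D 3 p)\<^sup>2"

lemma DD11 [simp]: "DD 1 1 p = 0"
proof -
  have "partial_deriv 1 v = (\<lambda>_. 0)" by auto
  then have "((partial_deriv 1 v) has_derivative (\<lambda>_. 0)) (at p)" by simp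
  from partial_deriv_eqI[OF this] show ?thesis .
qed

section \<open>Induced metric, area element and mean curvature of the graph\<close>

lemma conormal_length_eq: "geon.conormal_length p = W p"
  by (simp add: geon.conormal_length_def W_def sum_3 geon_coeff_def add_divide_distrib)

lemma induced_metric_nth:
  "induced_metric geon_metric (graph_param v) p $ a $ b
    = D a p * D b p + (if a = b then geon_coeff (torus_index a) (v p) else 0)"
  unfolding geon_metric_eq_diag
  by (simp add: induced_metric_def geon.inner_tangent geon.partial_deriv_graph_param_nth)
    (simp add: geon_coeff_def)

lemma W_sq_eq: "(W p)\<^sup>2 = (c p + q p) / c p"
  and c_plus_q_pos: "0 < c p + q p"
proof -
  show "0 < c p + q p" using c_pos[of p] by (smt (verit) zero_le_power2)
  show "(W p)\<^sup>2 = (c p + q p) / c p"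
    unfolding W_sq using c_pos[of p] by (simp add: field_simps)
qed

text \<open>Sherman-Morrison formula: the induced metric is diagonal plus the rank-one matrix of
  products of slopes. As \<open>D 1 p = 0\<close>, the correction lives in the \<theta>-block, where
  the diagonal is \<open>c p\<close>.\<close>

lemma matrix_inv_induced_metric:
  "matrix_inv (induced_metric geon_metric (graph_param v) p)
    = (\<chi> a b. (if a = b then 1 / geon_coeff (torus_index a) (v p) else 0)
         - D a p * D b p / (c p * (c p + q p)))"
proof (rule matrix_inv_eqI)
  define k where "k = c p + q p"
  \<comment> \<open>Eliminating the square of \<open>D 3 p\<close> in favour of \<open>k\<close>
    lets all entries normalise.\<close>
  have k: "k \<noteq> 0" and D3: "D 3 p * D 3 p = k - c p - D 2 p * D 2 p"
    using c_plus_q_pos[of p] unfolding k_def by (auto simp: power2_eq_square)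
  have D3': "D 3 p * (D 3 p * x) = (k - c p - D 2 p * D 2 p) * x" for x
    unfolding D3[symmetric] by simp
  show "induced_metric geon_metric (graph_param v) p ** (\<chi> a b.
      (if a = b then 1 / geon_coeff (torus_index a) (v p) else 0)
         - D a p * D b p / (c p * (c p + q p))) = mat 1"
    using u_pos[of p] c_pos[of p] k unfolding k_def[symmetric]
    by (simp add: vec_eq_iff forall_3 matrix_matrix_mult_def mat_def sum_3 induced_metric_nth geon_coeff_def)
      (simp add: field_simps power2_eq_square D3 D3')
qed

lemma det_induced_metric:
  "sqrt (det (induced_metric geon_metric (graph_param v) p)) = u p * geon_phi (v p) * W p"
proof -
  have "det (induced_metric geon_metric (graph_param v) p) = (u p * geon_phi (v p) * W p)\<^sup>2"
    unfolding power_mult_distrib W_sq geon_phi_sq det_3 induced_metric_nth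
    using c_pos[of p] by (simp add: geon_coeff_def field_simps power2_eq_square)
  then show ?thesis
    using u_pos[of p] W_ge_1[of p] geon_phi_pos[of "v p"] by simp
qed

lemma geon_form:
  "second_fundamental_form geon_metric (graph_param v) (graph_defining_fun v) p $ 1 $ 1
    = u p * ((c p)\<^sup>2 + 1) / (c p)\<^sup>2 / W p"
  "a \<noteq> 1 \<Longrightarrow> b \<noteq> 1 \<Longrightarrow>
    second_fundamental_form geon_metric (graph_param v) (graph_defining_fun v) p $ a $ b
    = (- DD a b p + 2 * u p / c p * (D a p * D b p) + (if a = b then u p else 0)) / W p"
proof -
  show "second_fundamental_form geon_metric (graph_param v) (graph_defining_fun v) p $ 1 $ 1
    = u p * ((c p)\<^sup>2 + 1) / (c p)\<^sup>2 / W p"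
    unfolding geon_metric_eq_diag geon.second_fundamental_form_eq conormal_length_eq
    by (simp add: geon_coeff_def geon_coeff'_def)
  assume ab: "a \<noteq> 1" "b \<noteq> 1"
  have t: "torus_index a \<noteq> 2" "torus_index b \<noteq> 2"
    using ab exhaust_3[of a] exhaust_3[of b] by auto
  show "second_fundamental_form geon_metric (graph_param v) (graph_defining_fun v) p $ a $ b
    = (- DD a b p + 2 * u p / c p * (D a p * D b p) + (if a = b then u p else 0)) / W p"
    unfolding geon_metric_eq_diag geon.second_fundamental_form_eq conormal_length_eq
    using t by (simp add: geon_coeff_def geon_coeff'_def)
qed

text \<open>The factor \<open>1 / W\<close> of the unit normal cancels against the area element, and
  the remaining weight \<open>u p * c p\<close> clears the denominator left by
  \<open>mean_curvature_algebra\<close>.\<close>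

lemma mean_curvature_density:
  "geon_phi (v p) * mean_curvature geon_metric (graph_param v) (graph_defining_fun v) p
     * sqrt (det (induced_metric geon_metric (graph_param v) p))
   = 3 * (c p)\<^sup>2 - 1 + u p * (- (DD 2 2 p + DD 3 3 p) + u p * q p / (c p + q p) + T p / (c p + q p))"
    (is "?L = ?R")
proof -
  let ?M = "matrix_inv (induced_metric geon_metric (graph_param v) p)"
  let ?h = "second_fundamental_form geon_metric (graph_param v) (graph_defining_fun v) p"
  let ?k = "c p + q p"
  have M: "?M $ 1 $ 1 = c p / (u p)\<^sup>2" "?M $ 1 $ 2 = 0" "?M $ 1 $ 3 = 0" "?M $ 2 $ 1 = 0" "?M $ 3 $ 1 = 0"
    "?M $ 2 $ 2 = 1 / c p - D 2 p * D 2 p / (c p * ?k)" "?M $ 2 $ 3 = - (D 2 p * D 3 p / (c p * ?k))"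
    "?M $ 3 $ 2 = - (D 3 p * D 2 p / (c p * ?k))" "?M $ 3 $ 3 = 1 / c p - D 3 p * D 3 p / (c p * ?k)"
    unfolding matrix_inv_induced_metric by (simp_all add: geon_coeff_def)
  have h: "?h $ 2 $ 2 = (- DD 2 2 p + 2 * u p / c p * (D 2 p * D 2 p) + u p) / W p"
    "?h $ 2 $ 3 = (- DD 2 3 p + 2 * u p / c p * (D 2 p * D 3 p)) / W p"
    "?h $ 3 $ 2 = (- DD 3 2 p + 2 * u p / c p * (D 3 p * D 2 p)) / W p"
    "?h $ 3 $ 3 = (- DD 3 3 p + 2 * u p / c p * (D 3 p * D 3 p) + u p) / W p"
    by (simp_all add: geon_form(2))
  have factor: "a1 * (x1 / w) + 0 * y1 + 0 * y2 + (0 * y3 + a2 * (x2 / w) + a3 * (x3 / w))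
      + (0 * y4 + a4 * (x4 / w) + a5 * (x5 / w)) = (a1 * x1 + a2 * x2 + a3 * x3 + a4 * x4 + a5 * x5) / w"
    for a1 a2 a3 a4 a5 x1 x2 x3 x4 x5 y1 y2 y3 y4 w :: real
    by (simp add: add_divide_distrib)
  have "mean_curvature geon_metric (graph_param v) (graph_defining_fun v) p = ?R / (u p * c p) / W p"
    unfolding mean_curvature_def sum_3 M h geon_form(1) factor T_def
    by (subst mean_curvature_algebra)
      (use u_sq[of p] u_pos[of p] c_pos[of p] c_plus_q_pos[of p] in simp_all)
  moreover have "c p * (u p * W p * (x / (u p * c p) / W p)) = x" for x
    using u_pos[of p] c_pos[of p] W_ge_1[of p] by simp
  moreover have "?L = (geon_phi (v p))\<^sup>2 * (u p * W p *
      mean_curvature geon_metric (graph_param v) (graph_defining_fun v) p)"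
    unfolding det_induced_metric by (simp add: power2_eq_square)
  ultimately show ?thesis
    unfolding geon_phi_sq by simp
qed

text \<open>The deficit of the weighted Minkowski inequality. The two brackets are \<open>S\<close> evaluated on
  \<open>Dv\<close> rotated by a right angle and on \<open>Dv\<close>; together they are what remains of the second derivatives
  of \<open>v\<close> in the density of \<open>\<phi> H\<close> once the divergence of \<open>sinh (2 v) Dv / W\<close> is added.\<close>

definition "excess p = u p / (c p * W p * (W p + 1)) *
     ((S 2 2 p * (D 3 p)\<^sup>2 + (S 2 3 p + S 3 2 p) * (D 3 p * - D 2 p) + S 3 3 p * (- D 2 p)\<^sup>2)
      + (S 2 2 p * (D 2 p)\<^sup>2 + (S 2 3 p + S 3 2 p) * (D 2 p * D 3 p) + S 3 3 p * (D 3 p)\<^sup>2) / (W p)\<^sup>2)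
   + (3 * (c p)\<^sup>2 - 1) * (W p - 1)\<^sup>2 / W p"

definition "flux a p = u p * D a p / W p"

text \<open>The derivative of \<open>flux a\<close> in its own direction, by
  \<open>flux_derivative\<close>; summed over the two \<theta>-directions it is the
  divergence.\<close>

definition "flux' a p = 2 * c p * (D a p)\<^sup>2 / W p + u p * DD a a p / W p
   - u p / W p ^ 3 * D a p * ((DD a 2 p * D 2 p + DD a 3 p * D 3 p) / c p - q p * D a p * u p / (c p)\<^sup>2)"

lemma density_eq:
  "geon_phi (v p) * mean_curvature geon_metric (graph_param v) (graph_defining_fun v) p
     * sqrt (det (induced_metric geon_metric (graph_param v) p))
   = 3 * (c p)\<^sup>2 - 1 + excess p - (flux' 2 p + flux' 3 p)"
proof -
  have k: "c p + q p = c p * (W p)\<^sup>2"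
    using W_sq_eq[of p] c_pos[of p] by (simp add: field_simps)
  have Q: "q p = c p * ((W p)\<^sup>2 - 1)"
    using k by (simp add: algebra_simps)
  \<comment> \<open>In two dimensions a form on the rotated gradient is \<open>q\<close> times its
    trace minus its value on the gradient. The rank-one part of \<open>S\<close> vanishes on the
    rotated gradient.\<close>
  have 1: "S 2 2 p * (D 3 p)\<^sup>2 + (S 2 3 p + S 3 2 p) * (D 3 p * - D 2 p) + S 3 3 p * (- D 2 p)\<^sup>2
      = - (q p * (DD 2 2 p + DD 3 3 p) - T p) + (2 * (c p)\<^sup>2 / u p + u p) * q p"
    by (simp add: S_def T_def algebra_simps add_divide_distrib power2_eq_square)
  have 2: "S 2 2 p * (D 2 p)\<^sup>2 + (S 2 3 p + S 3 2 p) * (D 2 p * D 3 p) + S 3 3 p * (D 3 p)\<^sup>2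
      = - T p + (2 * c p / u p + 2 * u p / c p) * (q p)\<^sup>2 + (2 * (c p)\<^sup>2 / u p + u p) * q p"
    by (simp add: S_def T_def algebra_simps add_divide_distrib power2_eq_square)
  have 3: "flux' 2 p + flux' 3 p = 2 * c p * q p / W p + u p * (DD 2 2 p + DD 3 3 p) / W p
      - u p / W p ^ 3 * (T p / c p - (q p)\<^sup>2 * u p / (c p)\<^sup>2)"
    by (simp add: flux'_def T_def add_divide_distrib diff_divide_distrib algebra_simps power2_eq_square)
  show ?thesis
    unfolding mean_curvature_density excess_def 1 2 3
    using excess_algebra[OF c_pos u_pos W_ge_1 u_sq Q, of "DD 2 2 p + DD 3 3 p" "T p"]
    unfolding k by simp
qed

text \<open>Convexity applied to the rotated gradient \<open>(D 3 p, - D 2 p)\<close> and to the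
  gradient makes both brackets of \<open>excess\<close> non-negative; the remaining summand has a
  positive coefficient because \<open>c p\<close> is at least 1.\<close>

lemma excess_nonneg:
  assumes "nonneg_definite (second_fundamental_form conformal_geon_metric (graph_param v) (graph_defining_fun v) p)"
  shows "(3 * (c p)\<^sup>2 - 1) * (W p - 1)\<^sup>2 / W p \<le> excess p" "0 \<le> excess p"
proof -
  have w: "0 < W p" using W_ge_1[of p] by simp
  show 1: "(3 * (c p)\<^sup>2 - 1) * (W p - 1)\<^sup>2 / W p \<le> excess p"
  proof -
    have "0 \<le> u p / (c p * W p * (W p + 1))"
      using u_pos[of p] c_pos[of p] w by simp
    from mult_nonneg_nonneg[OF this add_nonneg_nonneg[OF S_nonneg[OF assms, of "D 3 p" "- D 2 p"]
      divide_nonneg_nonneg[OF S_nonneg[OF assms, of "D 2 p" "D 3 p"] zero_le_power2[of "W p"]]]]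
    show ?thesis unfolding excess_def by linarith
  qed
  have "0 \<le> 3 * (c p)\<^sup>2 - 1" using u_sq[of p] zero_le_power2[of "u p"] by linarith
  then have "0 \<le> (3 * (c p)\<^sup>2 - 1) * (W p - 1)\<^sup>2 / W p"
    using w by simp
  with 1 show "0 \<le> excess p" by linarith
qed

lemma excess_eq_0D:
  assumes "nonneg_definite (second_fundamental_form conformal_geon_metric (graph_param v) (graph_defining_fun v) p)"
    and "excess p = 0"
  shows "D a p = 0"
proof -
  have w: "0 < W p" using W_ge_1[of p] by simp
  have k: "0 < 3 * (c p)\<^sup>2 - 1" using u_sq[of p] zero_less_power[OF u_pos[of p], of 2] by linarith
  have "(3 * (c p)\<^sup>2 - 1) * (W p - 1)\<^sup>2 / W p \<le> 0"
    using excess_nonneg(1)[OF assms(1)] assms(2) by simp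
  then have "(3 * (c p)\<^sup>2 - 1) * (W p - 1)\<^sup>2 \<le> 0"
    using w by (simp add: divide_le_0_iff)
  then have "(W p - 1)\<^sup>2 \<le> 0" using k by (simp add: mult_le_0_iff)
  then have "W p = 1" by simp
  then have "q p = 0" using W_sq[of p] c_pos[of p] by simp
  then have "D 2 p = 0" "D 3 p = 0" by (simp_all add: sum_power2_eq_zero_iff)
  then show ?thesis using exhaust_3[of a] by auto
qed

lemma excess_critical: "D 2 p = 0 \<Longrightarrow> D 3 p = 0 \<Longrightarrow> excess p = 0"
  by (simp add: excess_def W_def)

section \<open>Continuity, the divergence term and the integral formula for \<open>Q\<close>\<close>

lemma continuous_base:
  "continuous_on A v" "continuous_on A (partial_deriv a v)" "continuous_on A (partial_deriv a (partial_deriv b v))"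
  by (intro smooth_map_continuous smooth_map_partial_deriv smooth)+

lemma continuous_W: "continuous_on A W"
  unfolding W_def[abs_def] by (intro continuous_intros continuous_base) simp

lemma continuous_S: "continuous_on A (S a b)"
proof -
  have "u p \<noteq> 0" for p using u_pos[of p] by simp
  then show ?thesis
    unfolding S_def[abs_def] by (cases "a = b") (auto intro!: continuous_intros continuous_base)
qed

lemma continuous_excess: "continuous_on A excess"
  and continuous_flux: "continuous_on A (flux a)"
  and continuous_flux': "continuous_on A (flux' a)"
proof -
  have nz: "W p \<noteq> 0" "W p + 1 \<noteq> 0" "c p \<noteq> 0" for p using W_ge_1[of p] by auto
  show "continuous_on A excess"
    unfolding excess_def[abs_def] using nz
    by (intro continuous_intros continuous_base continuous_W continuous_S) auto
  show "continuous_on A (flux a)" "continuous_on A (flux' a)"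
    unfolding flux_def[abs_def] flux'_def[abs_def] using nz
    by (intro continuous_intros continuous_base continuous_W; auto)+
qed

lemma flux_derivative:
  "((\<lambda>t. flux a (x + t *\<^sub>R axis a 1)) has_real_derivative flux' a (x + t *\<^sub>R axis a 1)) (at t)"
proof -
  let ?x = "\<lambda>t. x + t *\<^sub>R axis a 1"
  have dv: "((\<lambda>t. v (?x t)) has_real_derivative D a (?x t)) (at t)"
    by (intro partial_deriv_has_real_derivative smooth_map_differentiable smooth)
  have dD: "((\<lambda>t. D b (?x t)) has_real_derivative DD a b (?x t)) (at t)" for b
    by (intro partial_deriv_has_real_derivative smooth_map_differentiable smooth_map_partial_deriv smooth)
  have nz: "W (?x t) \<noteq> 0" "0 < 1 + q (?x t) / c (?x t)"
    using W_ge_1[of "?x t"] W_sq[of "?x t"] zero_less_power[of "W (?x t)" 2] by auto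
  let ?W' = "((DD a 2 (?x t) * D 2 (?x t) + DD a 3 (?x t) * D 3 (?x t)) / c (?x t)
     - q (?x t) * D a (?x t) * u (?x t) / (c (?x t))\<^sup>2) / W (?x t)"
  \<comment> \<open>This is the derivative of \<open>W\<^sup>2\<close>, written as
    \<open>2 W' W\<close> so that the square root has derivative \<open>?W'\<close>.\<close>
  have dq: "((\<lambda>t. 1 + q (?x t) / c (?x t)) has_real_derivative 2 * (?W' * W (?x t))) (at t)"
    using nz by (auto intro!: derivative_eq_intros dv dD simp: field_simps power2_eq_square)
  have cancel: "inverse w / 2 * (2 * (z / w * w)) = z / w" if "w \<noteq> 0" for w z :: real
    using that by (simp add: field_simps)
  have "((\<lambda>t. sqrt (1 + q (?x t) / c (?x t))) has_real_derivative ?W') (at t)"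
    by (rule DERIV_cong[OF DERIV_chain2[OF DERIV_real_sqrt[OF nz(2)] dq]],
        unfold W_def[symmetric], rule cancel[OF nz(1)])
  then have dW: "((\<lambda>t. W (?x t)) has_real_derivative ?W') (at t)"
    unfolding W_def[symmetric] .
  have du: "((\<lambda>t. u (?x t)) has_real_derivative 2 * c (?x t) * D a (?x t)) (at t)"
    by (auto intro!: derivative_eq_intros dv)
  show ?thesis
    unfolding flux_def[abs_def]
    by (rule DERIV_cong[OF DERIV_divide[OF DERIV_mult[OF du dD] dW nz(1)]])
      (use nz(1) in \<open>simp add: flux'_def field_simps power2_eq_square power3_eq_cube\<close>)
qed

lemma geon_Q_eq:
  assumes per: "\<And>p. v (p + axis 1 pi) = v p" "\<And>p. v (p + axis 2 a3) = v p" "\<And>p. v (p + axis 3 a4) = v p"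
    and a: "0 < a3" "0 < a4"
  shows "geon_Q a3 a4 v = 2 * geon_mass a3 a4 - integral (cbox 0 (torus_top a3 a4)) excess"
proof -
  let ?K = "cbox 0 (torus_top a3 a4)"
  let ?dens = "\<lambda>p. 3 * (c p)\<^sup>2 - 1 + excess p - (flux' 2 p + flux' 3 p)"
  have int: "(f has_integral integral ?K f) ?K" if "continuous_on ?K f" for f :: "real^3 \<Rightarrow> real"
    using that integrable_continuous by blast
  have c2: "continuous_on A (\<lambda>p. 3 * (c p)\<^sup>2)" for A
    by (intro continuous_intros continuous_base)
  have flux0: "integral ?K (flux' i) = 0" if i: "i = 2 \<or> i = 3" for i
  proof -
    define P where "P = torus_top a3 a4 $ i"
    have P: "0 < P" using torus_top_pos[OF a] by (simp add: P_def)
    have "P *\<^sub>R axis i 1 = axis i P" by (simp add: axis_def vec_eq_iff)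
    then have vP: "v (p + P *\<^sub>R axis i 1) = v p" for p
      using i per by (auto simp: P_def torus_top_def)
    show ?thesis
    proof (rule integral_periodic_derivative[where f = "flux i" and e = "axis i 1" and P = P])
      \<comment> \<open>The period of \<open>v\<close> passes to its partial derivatives by
        \<open>partial_deriv_periodic\<close>.\<close>
      show "flux i (x + P *\<^sub>R axis i 1) = flux i x" for x
        by (simp add: flux_def W_def vP partial_deriv_periodic[of v, OF vP] smooth_map_differentiable[OF smooth])
    qed (use P flux_derivative continuous_flux continuous_flux' in
        \<open>auto simp: P_def inner_axis\<close>)
  qed
  have "measure lborel ?K = pi * a3 * a4"
  proof -
    have "(0 :: real^3) \<bullet> b \<le> torus_top a3 a4 \<bullet> b" if "b \<in> Basis" for b
      using that torus_top_pos[OF a] by (auto simp: Basis_vec_def inner_axis less_imp_le)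
    then show ?thesis
      by (subst content_cbox) (simp_all add: prod_Basis_vec inner_axis torus_top_def prod_UNIV_3 mult.assoc)
  qed
  note vol = this
  have "((\<lambda>_. 1 :: real) has_integral measure lborel ?K) ?K"
    using has_integral_const[of "1 :: real" 0 "torus_top a3 a4"] by simp
  note 1 = this
  have "(LINT p:torus_cell a3 a4|lborel. geon_phi (v p)
          * mean_curvature geon_metric (graph_param v) (graph_defining_fun v) p
          * sqrt (det (induced_metric geon_metric (graph_param v) p))) = integral ?K ?dens"
    unfolding density_eq
    by (intro LINT_torus_cell continuous_intros continuous_base continuous_excess continuous_flux')
  also have "\<dots> = integral ?K (\<lambda>p. 3 * (c p)\<^sup>2) - measure lborel ?K + integral ?K excess"
  proof (rule integral_unique)
    have "(flux' i has_integral 0) ?K" if "i = 2 \<or> i = 3" for i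
      using int[OF continuous_flux', of i] flux0[OF that] by simp
    then have flux: "((\<lambda>p. flux' 2 p + flux' 3 p) has_integral 0 + 0) ?K"
      by (intro has_integral_add) simp_all
    show "(?dens has_integral integral ?K (\<lambda>p. 3 * (c p)\<^sup>2) - measure lborel ?K + integral ?K excess) ?K"
      using has_integral_diff[OF has_integral_add[OF has_integral_diff[OF int[OF c2] 1] int[OF continuous_excess]] flux]
      unfolding add_0_right diff_0_right .
  qed
  finally have H: "(LINT p:torus_cell a3 a4|lborel. geon_phi (v p)
          * mean_curvature geon_metric (graph_param v) (graph_defining_fun v) p
          * sqrt (det (induced_metric geon_metric (graph_param v) p)))
     = integral ?K (\<lambda>p. 3 * (c p)\<^sup>2) - measure lborel ?K + integral ?K excess" .
  have "(LINT x:enclosed_region a3 a4 v|lborel. geon_phi (x$1) * sqrt (det (geon_metric x)))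
     = (LINT x:enclosed_region a3 a4 v|lborel. (\<lambda>s. cosh (2 * s) * sinh (2 * s)) (x$1))"
    unfolding set_lebesgue_integral_def
  proof (intro Bochner_Integration.integral_cong refl)
    fix x :: "real^4"
    have "geon_phi (x$1) * sqrt (det (geon_metric x)) = cosh (2 * x$1) * sinh (2 * x$1)"
      if "x \<in> enclosed_region a3 a4 v"
    proof -
      \<comment> \<open>Non-negative height fixes the sign when the square root of the determinant
        is taken.\<close>
      have s: "0 \<le> sinh (2 * x$1)" using that by (simp add: enclosed_region_def)
      have "det (geon_metric x) = (\<Prod>i\<in>UNIV. geon_metric x $ i $ i)"
        by (rule det_diagonal) (simp add: geon_metric_def)
      also have "\<dots> = (sinh (2 * x$1) * geon_phi (x$1))\<^sup>2"
        by (simp add: prod_torus_index prod_UNIV_3 geon_metric_eq_diag diag_metric_def geon_coeff_def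
            power_mult_distrib geon_phi_sq)
      finally have "sqrt (det (geon_metric x)) = sinh (2 * x$1) * geon_phi (x$1)"
        using s geon_phi_pos[of "x$1"] by simp
      then show ?thesis using geon_phi_sq[of "x$1"] by (simp add: power2_eq_square)
    qed
    then show "indicator (enclosed_region a3 a4 v) x *\<^sub>R (geon_phi (x$1) * sqrt (det (geon_metric x)))
      = indicator (enclosed_region a3 a4 v) x *\<^sub>R (cosh (2 * x$1) * sinh (2 * x$1))"
      by (simp add: indicator_def)
  qed
  \<comment> \<open>The antiderivative has value \<open>1 / 4\<close> at the core, so twelve times
    the volume term is the integral of \<open>3 (c\<^sup>2 - 1)\<close>.\<close>
  also have "\<dots> = (LINT p:torus_cell a3 a4|lborel. (\<lambda>s. (cosh (2 * s))\<^sup>2 / 4) (v p) - (\<lambda>s. (cosh (2 * s))\<^sup>2 / 4) 0)"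
  proof (rule LINT_enclosed_region)
    show "((\<lambda>s. (cosh (2 * s))\<^sup>2 / 4) has_real_derivative cosh (2 * s) * sinh (2 * s)) (at s)" for s :: real
      by (auto intro!: derivative_eq_intros)
    show "continuous_on UNIV (\<lambda>s::real. cosh (2 * s) * sinh (2 * s))"
      by (intro continuous_intros)
    show "0 \<le> v p" for p using v_pos[of p] by simp
  qed (rule continuous_base)
  also have "\<dots> = integral ?K (\<lambda>p. (c p)\<^sup>2 / 4 - 1 / 4)"
    by (subst LINT_torus_cell) (auto intro!: continuous_intros continuous_base)
  also have "12 * \<dots> = integral ?K (\<lambda>p. 3 * (c p)\<^sup>2 - 3)"
    by (subst integral_mult_right[symmetric]) (simp add: algebra_simps)
  also have "\<dots> = integral ?K (\<lambda>p. 3 * (c p)\<^sup>2) - 3 * measure lborel ?K"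
    using has_integral_diff[OF int[OF c2] has_integral_mult_right[OF 1, of 3]]
    by (intro integral_unique) simp
  \<comment> \<open>The terms \<open>3 c\<^sup>2\<close> cancel and the constants \<open>-3\<close>
    and \<open>+1\<close> leave \<open>-2\<close> times the cell volume, which is twice the
    mass.\<close>
  finally show ?thesis
    unfolding geon_Q_def geon_mass_def H using vol by simp
qed

end

section \<open>From the period cell to the whole torus, and the inequality\<close>

lemma periodic_int_shift:
  fixes f :: "'a::real_vector \<Rightarrow> 'b"
  assumes "\<And>x. f (x + w) = f x"
  shows "f (x + of_int n *\<^sub>R w) = f x"
proof (induction n rule: int_induct[where k = 0])
  case (step1 i)
  then show ?case using assms[of "x + of_int i *\<^sub>R w"] by (simp add: scaleR_add_left add.assoc)
next
  case (step2 i)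
  then show ?case using assms[of "x + of_int (i - 1) *\<^sub>R w"] by (simp add: scaleR_diff_left)
qed simp

text \<open>Each coordinate is reduced modulo its period by subtracting an integer part. Constancy
  on the cell thereby extends to all parameters.\<close>

lemma torus_cell_representative:
  assumes per: "\<And>p. v (p + axis 1 pi) = v p" "\<And>p. v (p + axis 2 a3) = v p" "\<And>p. v (p + axis 3 a4) = v p"
    and a: "0 < a3" "0 < a4"
  shows "\<exists>p'\<in>torus_cell a3 a4. v p' = v p"
proof -
  have red: "x + of_int (- \<lfloor>x / P\<rfloor>) * P \<in> {0..<P}" if "0 < P" for x P :: real
  proof -
    have "x / P - of_int \<lfloor>x / P\<rfloor> \<in> {0..<1}" by (auto simp: floor_le_iff) linarith
    then have "(x / P - of_int \<lfloor>x / P\<rfloor>) * P \<in> {0..<P}" using that by auto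
    then show ?thesis using that by (simp add: algebra_simps)
  qed
  let ?n = "\<lambda>i P. - \<lfloor>p $ i / P\<rfloor>"
  let ?p = "p + of_int (?n 1 pi) *\<^sub>R axis 1 pi + of_int (?n 2 a3) *\<^sub>R axis 2 a3 + of_int (?n 3 a4) *\<^sub>R axis 3 a4"
  have "v ?p = v p"
    by (simp only: periodic_int_shift[of v, OF per(1)] periodic_int_shift[of v, OF per(2)]
        periodic_int_shift[of v, OF per(3)])
  moreover have "?p \<in> torus_cell a3 a4"
    using red[OF pi_gt_zero, of "p $ 1"] red[OF a(1), of "p $ 2"] red[OF a(2), of "p $ 3"]
    by (simp add: torus_cell_def axis_def)
  ultimately show ?thesis by blast
qed

lemma graph_surface_eq_slice_iff: "graph_surface v = {x. x $ 1 = c} \<longleftrightarrow> (\<forall>p. v p = c)"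
proof
  assume eq: "graph_surface v = {x. x $ 1 = c}"
  show "\<forall>p. v p = c"
  proof
    fix p
    have "graph_param v p \<in> graph_surface v" by (simp add: graph_surface_def)
    then show "v p = c" unfolding eq by simp
  qed
qed (auto simp: graph_surface_def)

theorem theorem1p2:
  fixes a3 a4 :: real and v :: "real^3 \<Rightarrow> real"
  assumes "0 < a3" and "a3 \<le> a4"
    and "smooth_on_torus a3 a4 v"
    and "\<forall>p. 0 \<le> v p"
    and "xi_symmetric v"
    and "\<forall>p. nonneg_definite
          (second_fundamental_form conformal_geon_metric (graph_param v) (graph_defining_fun v) p)"
    and "\<forall>x\<in>graph_surface v. (geon_phi (x$1))^4 \<ge> 1 + 2 / sqrt 3"
  shows "geon_Q a3 a4 v \<le> 2 * geon_mass a3 a4 \<and>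
    (geon_Q a3 a4 v = 2 * geon_mass a3 a4 \<longleftrightarrow> (\<exists>c. graph_surface v = {x. x$1 = c}))"
proof -
  have smooth: "smooth_map v"
    and per: "\<And>p. v (p + axis 1 pi) = v p" "\<And>p. v (p + axis 2 a3) = v p" "\<And>p. v (p + axis 3 a4) = v p"
    using assms(3) by (auto simp: smooth_on_torus_def)
  have a: "0 < a3" "0 < a4" using assms(1,2) by auto
  \<comment> \<open>The lower bound on \<open>\<phi>\<^sup>4\<close> exceeds 1, while
    \<open>geon_phi 0 = 1\<close>; hence the graph misses the core.\<close>
  have pos: "0 < v p" for p
  proof -
    have "graph_param v p \<in> graph_surface v" by (simp add: graph_surface_def)
    from bspec[OF assms(7) this] have "1 + 2 / sqrt 3 \<le> geon_phi (v p) ^ 4" by simp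
    moreover have "0 < 2 / sqrt (3 :: real)" by simp
    ultimately have "geon_phi (v p) \<noteq> 1" by auto
    then have "v p \<noteq> 0" by (auto simp: geon_phi_def)
    then show ?thesis using assms(4) by (simp add: order_less_le)
  qed
  have D1: "partial_deriv 1 v p = 0" for p
  proof -
    have "v (p + t *\<^sub>R axis 1 1) = v p" for t
      by (rule assms(5)[unfolded xi_symmetric_def, rule_format]) (simp add: axis_def)
    then have "(\<lambda>t. v (p + t *\<^sub>R axis 1 1)) = (\<lambda>t. v p)" by (rule ext)
    with partial_deriv_has_real_derivative[OF smooth_map_differentiable[OF smooth], of p 1 0]
    have "((\<lambda>t. v p) has_real_derivative partial_deriv 1 v p) (at 0)" by simp
    then show ?thesis by (rule DERIV_unique) (rule DERIV_const)
  qed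
  interpret geon_graph v by standard (fact smooth pos D1)+
  let ?K = "cbox 0 (torus_top a3 a4)"
  have Q: "geon_Q a3 a4 v = 2 * geon_mass a3 a4 - integral ?K excess"
    by (rule geon_Q_eq[OF per a])
  have nn: "0 \<le> excess p" for p using excess_nonneg(2) assms(6) by blast
  have int: "excess integrable_on ?K" using continuous_excess integrable_continuous by blast
  have "v p = v 0" if I: "integral ?K excess = 0" for p
  proof -
    \<comment> \<open>With nonempty interior, a continuous non-negative function of zero integral
      vanishes on the entire closed box.\<close>
    have "box 0 (torus_top a3 a4) \<noteq> {}"
      using torus_top_pos[OF a] by (auto simp: box_ne_empty Basis_vec_def inner_axis)
    then have "excess p = 0" if "p \<in> ?K" for p
      using has_integral_0_cbox_imp_0[OF continuous_excess nn _ _ that] int I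
      by (metis integrable_integral)
    then have "D i p = 0" if "p \<in> ?K" for i p
      using excess_eq_0D assms(6) that by blast
    then have "(v has_derivative (\<lambda>h. 0)) (at p within ?K)" if "p \<in> ?K" for p
      using has_derivative_partial_derivs[OF smooth_map_differentiable[OF smooth], of p] that
      by (simp add: has_derivative_at_withinI)
    \<comment> \<open>The box is convex, so a vanishing derivative gives a constant.\<close>
    then obtain k where k: "\<And>p. p \<in> ?K \<Longrightarrow> v p = k"
      using has_derivative_zero_constant[of ?K v] by auto
    have "v p = k" for p
      using torus_cell_representative[of v a3 a4 p, OF per a] torus_cell_bounds(2)[of a3 a4] k by (metis subsetD)
    then show ?thesis by simp
  qed
  moreover have "integral ?K excess = 0" if "\<forall>p. v p = k" for k
  proof -
    have "v = (\<lambda>_. k)" using that by auto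
    then have "(v has_derivative (\<lambda>_. 0)) (at p)" for p by simp
    then have "D i p = 0" for i p by (rule partial_deriv_eqI)
    then have "excess p = 0" for p by (intro excess_critical)
    then have "excess = (\<lambda>_. 0)" by (rule ext)
    then show ?thesis by simp
  qed
  ultimately have "integral ?K excess = 0 \<longleftrightarrow> (\<exists>k. graph_surface v = {x. x $ 1 = k})"
    unfolding graph_surface_eq_slice_iff by blast
  moreover have "0 \<le> integral ?K excess" by (rule integral_nonneg[OF int nn])
  ultimately show ?thesis unfolding Q by auto
qed

end
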